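(* Let $n\geq 3$ be odd and $m\geq n$. If $m$ is even, then the $m$-linear invariant $\tilde g=\tilde g_{n\times m}$ is indecomposable in the ring $R^{SO(n,\mathbb C)}(\mathbb Z)$, and it is also indecomposable in the ring $R^{O(n,\mathbb C)}(\mathbb Z)$. If $m$ is odd, then the $m$-linear invariant $\tilde h=\tilde h_{n\times m}$ is indecomposable in the ring $R^{SO(n,\mathbb C)}(\mathbb Z)$.
   Context: Write $n=2\nu+1$ and $\mu=\lfloor m/2\rfloor$. **Groups.** Coordinates on $\mathbb C^n$ are $x_1,y_1,\dots,x_\nu,y_\nu,z$, and $q=x_1y_1+\dots+x_\nu y_\nu+z^2$. $O(n,\mathbb C)$ is the group of linear automorphisms of $\mathbb C^n$ preserving $q$, and $SO(n,\mathbb C)$ is its component containing the identity. **Invariants.** $R=R_{n\times m}$ is the $\mathbb C$-algebra of polynomials in the coordinates $x_r^{(i)},y_r^{(i)},z^{(i)}$ of indeterminate $n$-dimensional vectors $v^{(1)},\dots,v^{(m)}$, and $R(\mathbb Z)$ is its subring of polynomials with integer coefficients. For $G=O(n,\mathbb C)$ or $SO(n,\mathbb C)$, $R^G$ is the subalgebra of polynomials invariant under the simultaneous action of $G$ on $m$-tuples of vectors, and $R^G(\mathbb Z)=R^G\cap R(\mathbb Z)$. A polynomial is $m$-linear if it is multilinear in $v^{(1)},\dots,v^{(m)}$. An element of $R^G(\mathbb Z)$ is indecomposable if it is not contained in the subring of $R^G(\mathbb Z)$ generated by the elements of $R^G(\mathbb Z)$ of lower degree (i.e. of total degree strictly less than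 that of the given element). **The polynomials $\tilde g$ and $\tilde h$.** Let $B^{(ij)}=\sum_{r=1}^\nu(x_r^{(i)}y_r^{(j)}+y_r^{(i)}x_r^{(j)})+2z^{(i)}z^{(j)}$ for $1\le i,j\le m$; let $D^{(i_1,\dots,i_n)}=\det[v^{(i_1)},\dots,v^{(i_n)}]$ be the determinant of the matrix with the given columns (coordinates in the order $x_1,y_1,\dots,x_\nu,y_\nu,z$); and let $\mathrm{Pf}^{(i_1,\dots,i_{2\lambda})}$ be the Pfaffian of the $2\lambda\times2\lambda$ skew-symmetric matrix whose $(k,l)$ entry for $k<l$ is $B^{(i_ki_l)}$ (the empty Pfaffian is $1$). If $m=2\mu$ is even, $\tilde g=2^{-(\mu-\nu)}\,\mathrm{Pf}^{(1,\dots,2\mu)}$, an $O(n,\mathbb C)$-invariant with integer coefficients. If $m$ is odd, $\tilde h=2^{-(\mu-\nu)}\sum_\pi \mathrm{sgn}\,\pi\cdot D^{(\pi(1),\dots,\pi(n))}\mathrm{Pf}^{(\pi(n+1),\dots,\pi(m))}$, the sum being over permutations $\pi\in\mathfrak S_m$ with $\pi(1)<\dots<\pi(n)$ and $\pi(n+1)<\dots<\pi(m)$; it is an $SO(n,\mathbb C)$-invariant with integer coefficients. *)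

theory Defs
  imports
    "HOL-Library.Poly_Mapping"
    "HOL-Analysis.Function_Topology"
    "HOL-Combinatorics.Permutations"
    "Jordan_Normal_Form.Determinant"
begin

text \<open>
  All indices start at 0. For n = 2 \<nu> + 1 the coordinates
  x_1, y_1, ..., x_\<nu>, y_\<nu>, z of an n-dimensional vector are numbered 0, ..., n - 1 in this
  order, so that, for r < n div 2, the (r+1)-st x-coordinate has number 2 * r, the (r+1)-st
  y-coordinate has number 2 * r + 1, and z has number n - 1. The vectors are numbered
  0, ..., m - 1. The pair (k, i) stands for the k-th coordinate of the i-th vector.
\<close>

section \<open>Polynomials in the coordinates of vectors\<close>

type_synonym monom = "(nat \<times> nat) \<Rightarrow>\<^sub>0 nat"
type_synonym cpoly = "monom \<Rightarrow>\<^sub>0 complex"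

definition Const :: "complex \<Rightarrow> cpoly" where
  "Const c = Poly_Mapping.single 0 c"

definition Var :: "nat \<Rightarrow> nat \<Rightarrow> cpoly" where
  "Var k i = Poly_Mapping.single (Poly_Mapping.single (k, i) 1) 1"

definition mdegree :: "monom \<Rightarrow> nat" where
  "mdegree t = (\<Sum>v\<in>Poly_Mapping.keys t. Poly_Mapping.lookup t v)"

text \<open>The zero polynomial gets degree 0; it lies in every subring anyway.\<close>

definition tdegree :: "cpoly \<Rightarrow> nat" where
  "tdegree p = Max (insert 0 (mdegree ` Poly_Mapping.keys p))"

definition subst :: "(nat \<times> nat \<Rightarrow> cpoly) \<Rightarrow> cpoly \<Rightarrow> cpoly" where
  "subst s p = (\<Sum>t\<in>Poly_Mapping.keys p. Const (Poly_Mapping.lookup p t) *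
      (\<Prod>v\<in>Poly_Mapping.keys t. s v ^ Poly_Mapping.lookup t v))"

definition Rpolys :: "nat \<Rightarrow> nat \<Rightarrow> cpoly set" where
  "Rpolys n m = {p. \<forall>t\<in>Poly_Mapping.keys p. Poly_Mapping.keys t \<subseteq> {..<n} \<times> {..<m}}"

definition RZpolys :: "nat \<Rightarrow> nat \<Rightarrow> cpoly set" where
  "RZpolys n m = {p \<in> Rpolys n m. \<forall>t. Poly_Mapping.lookup p t \<in> \<int>}"

definition multilinear :: "nat \<Rightarrow> nat \<Rightarrow> cpoly \<Rightarrow> bool" where
  "multilinear n m p \<longleftrightarrow> p \<in> Rpolys n m \<and>
     (\<forall>t\<in>Poly_Mapping.keys p. \<forall>i<m. (\<Sum>k<n. Poly_Mapping.lookup t (k, i)) = 1)"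

section \<open>The groups\<close>

definition qform :: "nat \<Rightarrow> complex vec \<Rightarrow> complex" where
  "qform n v = (\<Sum>r<n div 2. v $ (2 * r) * v $ (2 * r + 1)) + (v $ (n - 1))\<^sup>2"

definition O_group :: "nat \<Rightarrow> complex mat set" where
  "O_group n = {A \<in> carrier_mat n n. invertible_mat A \<and>
     (\<forall>v\<in>carrier_vec n. qform n (A *\<^sub>v v) = qform n v)}"

text \<open>
  The type of matrices carries no topology. Extending the entries of an n \<times> n matrix by zero embeds
  these matrices into a function space with the product topology, and the subspace
  topology on the image is the usual topology of the space of complex n \<times> n matrices.
\<close>

definition entries :: "nat \<Rightarrow> complex mat \<Rightarrow> (nat \<times> nat \<Rightarrow> complex)" where
  "entries n A = (\<lambda>(k, l). if k < n \<and> l < n then A $$ (k, l) else 0)"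

definition SO_group :: "nat \<Rightarrow> complex mat set" where
  "SO_group n = {A \<in> O_group n.
     connected_component (entries n ` O_group n) (entries n (1\<^sub>m n)) (entries n A)}"

section \<open>Invariants and indecomposability\<close>

text \<open>A matrix acts by replacing each indeterminate vector by its image.\<close>

definition act :: "nat \<Rightarrow> complex mat \<Rightarrow> cpoly \<Rightarrow> cpoly" where
  "act n A = subst (\<lambda>(k, i). \<Sum>l<n. Const (A $$ (k, l)) * Var l i)"

definition invariants :: "nat \<Rightarrow> nat \<Rightarrow> complex mat set \<Rightarrow> cpoly set" where
  "invariants n m G = {p \<in> Rpolys n m. \<forall>A\<in>G. act n A p = p}"

definition invariantsZ :: "nat \<Rightarrow> nat \<Rightarrow> complex mat set \<Rightarrow> cpoly set" where
  "invariantsZ n m G = invariants n m G \<inter> RZpolys n m"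

inductive_set subring_generated :: "'a::ring_1 set \<Rightarrow> 'a set" for S where
  one: "1 \<in> subring_generated S"
| incl: "p \<in> S \<Longrightarrow> p \<in> subring_generated S"
| uminus: "p \<in> subring_generated S \<Longrightarrow> - p \<in> subring_generated S"
| add: "p \<in> subring_generated S \<Longrightarrow> q \<in> subring_generated S \<Longrightarrow> p + q \<in> subring_generated S"
| mult: "p \<in> subring_generated S \<Longrightarrow> q \<in> subring_generated S \<Longrightarrow> p * q \<in> subring_generated S"

definition indecomposable :: "nat \<Rightarrow> nat \<Rightarrow> complex mat set \<Rightarrow> cpoly \<Rightarrow> bool" where
  "indecomposable n m G p \<longleftrightarrow> p \<in> invariantsZ n m G \<and>
     p \<notin> subring_generated {f \<in> invariantsZ n m G. tdegree f < tdegree p}"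

section \<open>The polynomials g and h\<close>

definition Bpoly :: "nat \<Rightarrow> nat \<Rightarrow> nat \<Rightarrow> cpoly" where
  "Bpoly n i j = (\<Sum>r<n div 2. Var (2 * r) i * Var (2 * r + 1) j + Var (2 * r + 1) i * Var (2 * r) j)
     + 2 * Var (n - 1) i * Var (n - 1) j"

definition Dpoly :: "nat \<Rightarrow> (nat \<Rightarrow> nat) \<Rightarrow> cpoly" where
  "Dpoly n s = Determinant.det (Matrix.mat n n (\<lambda>(k, l). Var k (s l)))"

text \<open>
  The Pfaffian of a skew-symmetric matrix of size 2 * l. The permutations summed over represent
  the perfect matchings of the index set, each exactly once.
\<close>

definition pfaffian :: "nat \<Rightarrow> 'a::comm_ring_1 mat \<Rightarrow> 'a" where
  "pfaffian l A = (\<Sum>\<sigma> | \<sigma> permutes {..<2 * l} \<and> (\<forall>i<l. \<sigma> (2 * i) < \<sigma> (2 * i + 1)) \<and>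
        (\<forall>i j. i < j \<and> j < l \<longrightarrow> \<sigma> (2 * i) < \<sigma> (2 * j)).
      of_int (sign \<sigma>) * (\<Prod>i<l. A $$ (\<sigma> (2 * i), \<sigma> (2 * i + 1))))"

definition Pfpoly :: "nat \<Rightarrow> nat \<Rightarrow> (nat \<Rightarrow> nat) \<Rightarrow> cpoly" where
  "Pfpoly n l s = pfaffian l (Matrix.mat (2 * l) (2 * l) (\<lambda>(a, b).
     if a < b then Bpoly n (s a) (s b) else if b < a then - Bpoly n (s b) (s a) else 0))"

definition g_poly :: "nat \<Rightarrow> nat \<Rightarrow> cpoly" where
  "g_poly n m = Const (2 powi (- (int (m div 2) - int (n div 2)))) * Pfpoly n (m div 2) (\<lambda>k. k)"

definition h_poly :: "nat \<Rightarrow> nat \<Rightarrow> cpoly" where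
  "h_poly n m = Const (2 powi (- (int (m div 2) - int (n div 2)))) *
     (\<Sum>\<pi> | \<pi> permutes {..<m} \<and> strict_mono_on {..<n} \<pi> \<and> strict_mono_on {n..<m} \<pi>.
        of_int (sign \<pi>) * Dpoly n \<pi> * Pfpoly n ((m - n) div 2) (\<lambda>k. \<pi> (n + k)))"

end

theory Submission imports Defs begin

text \<open>
  Both polynomials are detected by one coefficient taken modulo 2: that of the monomial of the word
  x_1 y_1 ... x_\<nu> y_\<nu> z ... z, in which the vectors are assigned these coordinates in turn
  (standard_word). It is 1 in g and in h (scaled_pairing_sum), and it is even in every
  element of the ring generated by the invariants of lower degree (indecomposable_criterion).

  For the second claim only products of two integral invariants matter. The coefficient of the word in
  a product is the sum, over all ways to distribute the vectors to the two factors, of products of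
  coefficients of subwords. A torus in SO(n) kills the coefficient of a subword that contains just
  one of x_r and y_r (coeff_unbalanced). So if both subwords are nonempty and the product does not
  vanish, one of them contains z and omits some pair x_r, y_r. Its coefficient is even
  (coeff_even): a rotation by a right angle takes the basis vector of z to the sum of those of
  x_r and y_r, so this coefficient is the sum of the coefficients of all words in which every z is
  replaced by x_r or y_r, and a rotation by two right angles matches these words in pairs by
  exchanging x_r and y_r, which leaves the coefficients unchanged up to sign.

  For the first claim, and for the integrality of g and h, both polynomials are written as signed sums
  over permutations of the vectors that determine d single vectors and l unordered pairs, with d = 0
  for g and d = n for h (pairing_sum). Evaluated at a word of basis vectors, such a sum F satisfies the
  relation of a Clifford algebra: exchanging two adjacent letters u, v gives -F + 2 B(u,v) F', where
  F' is the sum for the word without these letters (pairing_sum_transpose). By induction F' is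
  divisible by half the power of 2 required for F, so that F is antisymmetric modulo the
  required power. A word longer than n has a repeated letter; once its two occurrences have been
  made adjacent, the relation reads F = B(u,u) F' with B(u,u) = 0 or 2 (word_value_dvd). On the
  standard word the same relation removes the letters z two at a time, each time with a factor 2,
  and leaves the value 1 (word_value_standard_word).
\<close>

abbreviation lookup :: "('a \<Rightarrow>\<^sub>0 'b::zero) \<Rightarrow> 'a \<Rightarrow> 'b" where "lookup \<equiv> Poly_Mapping.lookup"
abbreviation keys :: "('a \<Rightarrow>\<^sub>0 'b::zero) \<Rightarrow> 'a set" where "keys \<equiv> Poly_Mapping.keys"

section \<open>Polynomials and substitution\<close>

lemma poly_expand: "p = (\<Sum>t\<in>keys p. Poly_Mapping.single t (lookup p t))"
  by (rule poly_mapping_eqI)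
     (auto simp: lookup_sum lookup_single when_def in_keys_iff if_distrib cong: if_cong)

lemma times_expand:
  fixes p q :: cpoly
  shows "p * q = (\<Sum>t\<in>keys p. \<Sum>u\<in>keys q. Poly_Mapping.single (t + u) (lookup p t * lookup q u))"
  by (subst (1) poly_expand[of p], subst (1) poly_expand[of q])
     (simp add: sum_product mult_single)

lemma lookup_times:
  fixes p q :: cpoly
  shows "lookup (p * q) s =
    (\<Sum>t\<in>keys p. \<Sum>u\<in>keys q. if t + u = s then lookup p t * lookup q u else 0)"
  by (subst times_expand) (simp add: lookup_sum lookup_single when_def)

lemma Const_mult: "Const a * Const b = Const (a * b)"
  by (simp add: Const_def mult_single)

lemma Const_add: "Const a + Const b = Const (a + b)"
  by (simp add: Const_def single_add)

lemma Const_0 [simp]: "Const 0 = 0"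
  by (simp add: Const_def)

lemma Const_1 [simp]: "Const 1 = 1"
  by (simp add: Const_def)

lemma Const_of_int [simp]: "Const (of_int k) = of_int k"
  by (simp add: Const_def)

lemma Const_sum: "Const (sum f A) = (\<Sum>a\<in>A. Const (f a))"
  by (induction A rule: infinite_finite_induct) (auto simp flip: Const_add)

lemma Const_prod: "Const (prod f A) = (\<Prod>a\<in>A. Const (f a))"
  by (induction A rule: infinite_finite_induct) (auto simp flip: Const_mult)

lemma Const_inject [simp]: "Const a = Const b \<longleftrightarrow> a = b"
  unfolding Const_def by (metis lookup_single_eq)

lemma lookup_Const_mult: "lookup (Const c * p) t = c * lookup p t"
proof -
  have "Const c * p = (\<Sum>u\<in>keys p. Poly_Mapping.single u (c * lookup p u))"
    by (subst (1) poly_expand[of p]) (simp add: Const_def sum_distrib_left mult_single)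
  then show ?thesis
    by (auto simp: lookup_sum lookup_single when_def in_keys_iff)
qed

definition subst_monom :: "(nat \<times> nat \<Rightarrow> cpoly) \<Rightarrow> monom \<Rightarrow> cpoly" where
  "subst_monom s t = (\<Prod>v\<in>keys t. s v ^ lookup t v)"

lemma subst_monom_superset:
  assumes "finite K" "keys t \<subseteq> K"
  shows "subst_monom s t = (\<Prod>v\<in>K. s v ^ lookup t v)"
  unfolding subst_monom_def
  by (rule prod.mono_neutral_left) (use assms in \<open>auto simp: in_keys_iff\<close>)

lemma subst_monom_add: "subst_monom s (t + u) = subst_monom s t * subst_monom s u"
proof -
  let ?K = "keys t \<union> keys u"
  have "keys (t + u) \<subseteq> ?K" by (rule keys_add)
  then have "subst_monom s (t + u) = (\<Prod>v\<in>?K. s v ^ lookup (t + u) v)"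
    by (intro subst_monom_superset) auto
  also have "\<dots> = (\<Prod>v\<in>?K. s v ^ lookup t v) * (\<Prod>v\<in>?K. s v ^ lookup u v)"
    by (simp add: lookup_add power_add prod.distrib)
  finally show ?thesis
    by (simp add: subst_monom_superset[of ?K t s] subst_monom_superset[of ?K u s])
qed

lemma subst_superset:
  assumes "finite K" "keys p \<subseteq> K"
  shows "subst s p = (\<Sum>t\<in>K. Const (lookup p t) * subst_monom s t)"
  unfolding subst_def subst_monom_def[symmetric]
  by (rule sum.mono_neutral_left) (use assms in \<open>auto simp: in_keys_iff\<close>)

lemma subst_single: "subst s (Poly_Mapping.single t c) = Const c * subst_monom s t"
  by (subst subst_superset[where K = "{t}"]) auto

lemma subst_add: "subst s (p + q) = subst s p + subst s q"
proof -
  let ?K = "keys p \<union> keys q"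
  have "keys (p + q) \<subseteq> ?K" by (rule keys_add)
  then show ?thesis
    by (simp add: subst_superset[of ?K "p + q" s] subst_superset[of ?K p s] subst_superset[of ?K q s]
        lookup_add sum.distrib distrib_right flip: Const_add)
qed

lemma subst_sum: "subst s (sum f A) = (\<Sum>a\<in>A. subst s (f a))"
proof -
  have "subst s 0 = 0" by (simp add: subst_def)
  then show ?thesis
    by (induction A rule: infinite_finite_induct) (auto simp: subst_add)
qed

lemma subst_mult: "subst s (p * q) = subst s p * subst s q"
proof -
  have "subst s (p * q) = (\<Sum>t\<in>keys p. \<Sum>u\<in>keys q. subst s (Poly_Mapping.single (t + u) (lookup p t * lookup q u)))"
    by (subst times_expand) (simp add: subst_sum)
  also have "\<dots> = (\<Sum>t\<in>keys p. \<Sum>u\<in>keys q.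
       (Const (lookup p t) * subst_monom s t) * (Const (lookup q u) * subst_monom s u))"
    by (simp add: subst_single subst_monom_add algebra_simps flip: Const_mult)
  also have "\<dots> = subst s p * subst s q"
    unfolding subst_def subst_monom_def[symmetric] by (simp add: sum_product)
  finally show ?thesis .
qed

lemma subst_Const [simp]: "subst s (Const c) = Const c"
  by (simp add: Const_def subst_single subst_monom_def)

interpretation subst_hom: comm_ring_hom "subst s" for s
proof
  show "subst s 0 = 0" by (simp add: subst_def)
  show "subst s 1 = 1" using subst_Const[of s 1] by simp
qed (auto simp: subst_add subst_mult)

lemma subst_Var [simp]: "subst s (Var k i) = s (k, i)"
  by (simp add: Var_def subst_single subst_monom_def)

lemma act_Const [simp]: "act n A (Const c) = Const c"
  by (simp add: act_def)

lemma act_Var: "act n A (Var k i) = (\<Sum>l<n. Const (A $$ (k, l)) * Var l i)"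
  by (simp add: act_def)

interpretation act_hom: comm_ring_hom "act n A" for n A
  unfolding act_def by unfold_locales

section \<open>Gradings\<close>

definition homog :: "(monom \<Rightarrow> nat) \<Rightarrow> nat \<Rightarrow> cpoly \<Rightarrow> bool" where
  "homog \<phi> d p \<longleftrightarrow> (\<forall>t\<in>keys p. \<phi> t = d)"

text \<open>The components of the multidegree that belongs to rescaling the single vectors; substitution of
  linear images for the vectors preserves it.\<close>

definition vdeg :: "nat \<Rightarrow> nat \<Rightarrow> monom \<Rightarrow> nat" where
  "vdeg n i t = (\<Sum>k<n. lookup t (k, i))"

lemma vdeg_0 [simp]: "vdeg n i 0 = 0"
  by (simp add: vdeg_def)

lemma vdeg_add: "vdeg n i (t + u) = vdeg n i t + vdeg n i u"
  by (simp add: vdeg_def lookup_add sum.distrib)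

lemma homog_0 [simp]: "homog \<phi> d 0"
  by (simp add: homog_def)

lemma homog_add: "homog \<phi> d p \<Longrightarrow> homog \<phi> d q \<Longrightarrow> homog \<phi> d (p + q)"
  unfolding homog_def using keys_add[of p q] by blast

lemma homog_sum: "(\<And>a. a \<in> A \<Longrightarrow> homog \<phi> d (f a)) \<Longrightarrow> homog \<phi> d (sum f A)"
  by (induction A rule: infinite_finite_induct) (auto intro: homog_add)

lemma homog_Const: "homog (vdeg n i) 0 (Const c)"
  by (simp add: homog_def Const_def)

lemma homog_Var: "k < n \<Longrightarrow> homog (vdeg n i) (of_bool (i = j)) (Var k j)"
  by (auto simp: homog_def Var_def vdeg_def lookup_single when_def)

lemma homog_mult:
  "homog (vdeg n i) d p \<Longrightarrow> homog (vdeg n i) e q \<Longrightarrow> homog (vdeg n i) (d + e) (p * q)"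
  unfolding homog_def using keys_mult[of p q] by (fastforce simp: vdeg_add)

lemma homog_Const_mult: "homog (vdeg n i) d p \<Longrightarrow> homog (vdeg n i) d (Const c * p)"
  using homog_mult[OF homog_Const, of n i d p c] by simp

lemma homog_prod:
  "(\<And>a. a \<in> A \<Longrightarrow> homog (vdeg n i) (d a) (f a)) \<Longrightarrow> homog (vdeg n i) (sum d A) (prod f A)"
  by (induction A rule: infinite_finite_induct)
     (auto intro: homog_mult homog_Const[where c = 1, simplified])

lemma homog_power: "homog (vdeg n i) d p \<Longrightarrow> homog (vdeg n i) (e * d) (p ^ e)"
  by (induction e) (auto intro: homog_mult homog_Const[where c = 1, simplified])

section \<open>Rings of polynomials\<close>

lemma Rpolys_add: "p \<in> Rpolys n m \<Longrightarrow> q \<in> Rpolys n m \<Longrightarrow> p + q \<in> Rpolys n m"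
  unfolding Rpolys_def using keys_add[of p q] by blast

lemma Rpolys_0 [simp]: "0 \<in> Rpolys n m"
  by (simp add: Rpolys_def)

lemma Rpolys_Const [simp]: "Const c \<in> Rpolys n m"
  by (simp add: Rpolys_def Const_def)

lemma Rpolys_1 [simp]: "1 \<in> Rpolys n m"
  using Rpolys_Const[of 1] by simp

lemma Rpolys_Var: "k < n \<Longrightarrow> i < m \<Longrightarrow> Var k i \<in> Rpolys n m"
  by (simp add: Rpolys_def Var_def)

lemma Rpolys_uminus: "p \<in> Rpolys n m \<Longrightarrow> - p \<in> Rpolys n m"
  by (simp add: Rpolys_def in_keys_iff)

lemma Rpolys_mult: "p \<in> Rpolys n m \<Longrightarrow> q \<in> Rpolys n m \<Longrightarrow> p * q \<in> Rpolys n m"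
proof -
  assume p: "p \<in> Rpolys n m" and q: "q \<in> Rpolys n m"
  show ?thesis unfolding Rpolys_def
  proof (intro CollectI ballI)
    fix s assume "s \<in> keys (p * q)"
    then obtain t u where "t \<in> keys p" "u \<in> keys q" "s = t + u"
      using keys_mult[of p q] by blast
    then show "keys s \<subseteq> {..<n} \<times> {..<m}"
      using keys_add[of t u] p q unfolding Rpolys_def by blast
  qed
qed

lemma Rpolys_sum: "(\<And>a. a \<in> A \<Longrightarrow> f a \<in> Rpolys n m) \<Longrightarrow> sum f A \<in> Rpolys n m"
  by (induction A rule: infinite_finite_induct) (auto intro: Rpolys_add)

lemma Rpolys_prod: "(\<And>a. a \<in> A \<Longrightarrow> f a \<in> Rpolys n m) \<Longrightarrow> prod f A \<in> Rpolys n m"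
  by (induction A rule: infinite_finite_induct) (auto intro: Rpolys_mult)

lemma invariantsZ_1: "1 \<in> invariantsZ n m G"
  by (auto simp: invariantsZ_def invariants_def RZpolys_def lookup_one when_def)

lemma invariantsZ_uminus: "p \<in> invariantsZ n m G \<Longrightarrow> - p \<in> invariantsZ n m G"
  by (auto simp: invariantsZ_def invariants_def RZpolys_def act_hom.hom_uminus Rpolys_uminus)

lemma invariantsZ_add:
  "p \<in> invariantsZ n m G \<Longrightarrow> q \<in> invariantsZ n m G \<Longrightarrow> p + q \<in> invariantsZ n m G"
  by (auto simp: invariantsZ_def invariants_def RZpolys_def act_hom.hom_add lookup_add Rpolys_add)

lemma invariantsZ_mult:
  "p \<in> invariantsZ n m G \<Longrightarrow> q \<in> invariantsZ n m G \<Longrightarrow> p * q \<in> invariantsZ n m G"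
  by (auto simp: invariantsZ_def invariants_def RZpolys_def act_hom.hom_mult lookup_times Rpolys_mult
      intro!: Ints_sum)

section \<open>Multilinear monomials\<close>

text \<open>A word is a map w from vectors to coordinates. Restricted to S, it stands for a monomial that is
  linear in the vectors of S and constant in the others, and equivalently for a tuple of vectors of
  the coordinate basis.\<close>

definition word_monom :: "nat set \<Rightarrow> (nat \<Rightarrow> nat) \<Rightarrow> monom" where
  "word_monom S w = (\<Sum>i\<in>S. Poly_Mapping.single (w i, i) 1)"

lemma lookup_word_monom:
  "finite S \<Longrightarrow> lookup (word_monom S w) (k, i) = (if i \<in> S \<and> w i = k then 1 else 0)"
proof -
  assume S: "finite S"
  have "lookup (word_monom S w) (k, i) = (\<Sum>j\<in>S. if j = i then (if w i = k then 1 else 0) else 0)"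
    unfolding word_monom_def lookup_sum by (rule sum.cong) (auto simp: lookup_single when_def)
  then show ?thesis using S by simp
qed

lemma vdeg_word_monom:
  assumes "finite S" "\<And>i. i \<in> S \<Longrightarrow> w i < n"
  shows "vdeg n i (word_monom S w) = (if i \<in> S then 1 else 0)"
  using assms by (auto simp: vdeg_def lookup_word_monom)

lemma word_monom_inject:
  assumes "finite S" "word_monom S v = word_monom S w" "i \<in> S"
  shows "v i = w i"
proof -
  have "lookup (word_monom S w) (v i, i) = 1"
    unfolding assms(2)[symmetric] using assms(3) by (simp add: lookup_word_monom[OF assms(1)])
  then show ?thesis by (simp add: lookup_word_monom[OF assms(1)] split: if_splits)
qed

lemma word_monom_cong: "(\<And>i. i \<in> S \<Longrightarrow> v i = w i) \<Longrightarrow> word_monom S v = word_monom S w"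
  unfolding word_monom_def by (rule sum.cong) auto

text \<open>A word monomial is squarefree, so a factor is determined by the vectors that occur in it.\<close>

lemma word_monom_split:
  assumes "finite S" "t + u = word_monom S w"
  shows "\<exists>T\<subseteq>S. t = word_monom T w \<and> u = word_monom (S - T) w"
proof -
  define T where "T = {i \<in> S. lookup t (w i, i) = 1}"
  have T: "finite T" "finite (S - T)" "T \<subseteq> S" using assms(1) by (auto simp: T_def)
  have sum: "lookup t (k, i) + lookup u (k, i) = (if i \<in> S \<and> w i = k then 1 else 0)" for k i
    using assms lookup_word_monom[OF assms(1)] by (metis lookup_add)
  have "lookup t v = lookup (word_monom T w) v" for v
    using sum[of "fst v" "snd v"] lookup_word_monom[OF T(1), of w "fst v" "snd v"]
    by (auto simp: T_def split: if_splits)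
  moreover have "lookup u v = lookup (word_monom (S - T) w) v" for v
    using sum[of "fst v" "snd v"] lookup_word_monom[OF T(2), of w "fst v" "snd v"]
    by (auto simp: T_def split: if_splits)
  ultimately have "t = word_monom T w" "u = word_monom (S - T) w" by (simp_all add: poly_mapping_eqI)
  then show ?thesis using T(3) by blast
qed

text \<open>In a monomial of degree 1 in the i-th vector exactly one coordinate of that vector occurs;
  this coordinate is the letter at i.\<close>

lemma word_monom_exists:
  assumes S: "S \<subseteq> {..<m}" and t: "keys t \<subseteq> {..<n} \<times> {..<m}"
    and deg: "\<And>i. i < m \<Longrightarrow> vdeg n i t = (if i \<in> S then 1 else 0)"
  shows "\<exists>w\<in>S \<rightarrow>\<^sub>E {..<n}. t = word_monom S w"
proof -
  have "\<forall>i\<in>S. \<exists>k<n. lookup t (k, i) = 1 \<and> (\<forall>k'<n. k' \<noteq> k \<longrightarrow> lookup t (k', i) = 0)"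
  proof
    fix i assume "i \<in> S"
    then have "(\<Sum>k<n. lookup t (k, i)) = 1" using S deg[of i] by (auto simp: vdeg_def)
    then show "\<exists>k<n. lookup t (k, i) = 1 \<and> (\<forall>k'<n. k' \<noteq> k \<longrightarrow> lookup t (k', i) = 0)"
      by (subst (asm) sum_eq_1_iff) auto
  qed
  then obtain f where f: "\<And>i. i \<in> S \<Longrightarrow> f i < n \<and> lookup t (f i, i) = 1 \<and>
      (\<forall>k'<n. k' \<noteq> f i \<longrightarrow> lookup t (k', i) = 0)"
    by metis
  define w where "w = restrict f S"
  have fin: "finite S" using S finite_subset by blast
  have "lookup t (k, i) = lookup (word_monom S w) (k, i)" for k i
  proof (cases "k < n \<and> i < m")
    case False
    then have "(k, i) \<notin> keys t" using t by auto
    moreover have "\<not> (i \<in> S \<and> w i = k)" using False S f by (auto simp: w_def)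
    ultimately show ?thesis by (simp add: lookup_word_monom[OF fin] in_keys_iff)
  next
    case True
    show ?thesis
    proof (cases "i \<in> S")
      case True
      then show ?thesis
        using f[OF True] \<open>k < n \<and> i < m\<close> by (auto simp: lookup_word_monom[OF fin] w_def)
    next
      case False
      then have "vdeg n i t = 0" using True deg by auto
      then have "lookup t (k, i) = 0" using True by (auto simp: vdeg_def)
      then show ?thesis using False by (simp add: lookup_word_monom[OF fin])
    qed
  qed
  then have "t = word_monom S w" by (intro poly_mapping_eqI) auto
  moreover have "w \<in> S \<rightarrow>\<^sub>E {..<n}" using f by (auto simp: w_def)
  ultimately show ?thesis by blast
qed

lemma word_monom_prod: 
  "finite S \<Longrightarrow> (\<Prod>i\<in>S. Var (w i) i) = Poly_Mapping.single (word_monom S w) 1"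
  by (induction S rule: finite_induct) (auto simp: word_monom_def Var_def mult_single)

lemma subst_monom_word_monom:
  assumes "finite S"
  shows "subst_monom s (word_monom S w) = (\<Prod>i\<in>S. s (w i, i))"
proof -
  have "subst_monom s (word_monom S w) = subst s (Poly_Mapping.single (word_monom S w) 1)"
    by (simp add: subst_single)
  also have "\<dots> = (\<Prod>i\<in>S. s (w i, i))"
    unfolding word_monom_prod[OF assms, symmetric] by (simp add: subst_hom.hom_prod)
  finally show ?thesis .
qed

text \<open>The multilinear coefficients transform under a matrix like the components of a tensor:
  a matrix maps polynomials that are homogeneous in every single vector to such polynomials
  of the same degrees, so that other coefficients do not interfere.\<close>

lemma lookup_act_word_monom:
  assumes p: "p \<in> Rpolys n m" and S: "S \<subseteq> {..<m}" and w: "\<And>i. i \<in> S \<Longrightarrow> w i < n"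
  shows "lookup (act n A p) (word_monom S w) =
    (\<Sum>v\<in>S \<rightarrow>\<^sub>E {..<n}. lookup p (word_monom S v) * (\<Prod>i\<in>S. A $$ (v i, w i)))"
proof -
  define s where "s = (\<lambda>(k, i). \<Sum>l<n. Const (A $$ (k, l)) * Var l i)"
  have fin: "finite S" using S finite_subset by blast
  have finP: "finite (S \<rightarrow>\<^sub>E {..<n})" using fin by (intro finite_PiE) auto
  have deg: "homog (vdeg n i) (vdeg n i t) (subst_monom s t)"
    if "keys t \<subseteq> {..<n} \<times> {..<m}" for i t
  proof -
    have "homog (vdeg n i) (of_bool (i = snd v)) (s v)" for v
      unfolding s_def case_prod_beta by (intro homog_sum homog_Const_mult homog_Var) simp
    then have "homog (vdeg n i) (\<Sum>v\<in>keys t. lookup t v * of_bool (i = snd v)) (subst_monom s t)"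
      unfolding subst_monom_def by (intro homog_prod homog_power)
    moreover have "(\<Sum>v\<in>keys t. lookup t v * of_bool (i = snd v)) = vdeg n i t"
    proof -
      have "(\<Sum>v\<in>keys t. lookup t v * of_bool (i = snd v))
        = (\<Sum>v\<in>keys t \<inter> {v. i = snd v}. lookup t v)"
        by (simp add: sum.inter_restrict of_bool_def if_distrib cong: if_cong)
      also have "\<dots> = (\<Sum>v\<in>(\<lambda>k. (k, i)) ` {..<n}. lookup t v)"
        by (rule sum.mono_neutral_left) (use that in \<open>auto simp: in_keys_iff\<close>)
      also have "\<dots> = vdeg n i t"
        unfolding vdeg_def by (subst sum.reindex) (auto simp: inj_on_def)
      finally show ?thesis .
    qed
    ultimately show ?thesis by simp
  qed
  have zero: "lookup (subst_monom s t) (word_monom S w) = 0"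
    if t: "t \<in> keys p" "t \<notin> word_monom S ` (S \<rightarrow>\<^sub>E {..<n})" for t
  proof (rule ccontr)
    assume "\<not> ?thesis"
    then have in_keys: "word_monom S w \<in> keys (subst_monom s t)" by (simp add: in_keys_iff)
    have kt: "keys t \<subseteq> {..<n} \<times> {..<m}" using p t(1) by (auto simp: Rpolys_def)
    have "vdeg n i t = (if i \<in> S then 1 else 0)" for i
      using deg[OF kt, of i] in_keys vdeg_word_monom[OF fin w, where i = i] by (auto simp: homog_def)
    with word_monom_exists[OF S kt] t(2) show False by auto
  qed
  have one: "lookup (subst_monom s (word_monom S v)) (word_monom S w) = (\<Prod>i\<in>S. A $$ (v i, w i))" for v
  proof -
    have "subst_monom s (word_monom S v) = (\<Prod>i\<in>S. \<Sum>l<n. Const (A $$ (v i, l)) * Var l i)"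
      using subst_monom_word_monom[OF fin] by (simp add: s_def)
    also have "\<dots> = (\<Sum>u\<in>S \<rightarrow>\<^sub>E {..<n}. \<Prod>i\<in>S. Const (A $$ (v i, u i)) * Var (u i) i)"
      using fin by (subst prod_sum_PiE) auto
    also have "\<dots> = (\<Sum>u\<in>S \<rightarrow>\<^sub>E {..<n}. Const (\<Prod>i\<in>S. A $$ (v i, u i)) * Poly_Mapping.single (word_monom S u) 1)"
      using fin by (simp add: prod.distrib word_monom_prod Const_prod)
    finally have "lookup (subst_monom s (word_monom S v)) (word_monom S w) =
        (\<Sum>u\<in>S \<rightarrow>\<^sub>E {..<n}. (\<Prod>i\<in>S. A $$ (v i, u i)) * (if word_monom S u = word_monom S w then 1 else 0))"
      by (simp add: lookup_sum lookup_Const_mult lookup_single when_def)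
    also have "\<dots> = (\<Sum>u\<in>S \<rightarrow>\<^sub>E {..<n}. if u = restrict w S then \<Prod>i\<in>S. A $$ (v i, w i) else 0)"
    proof (rule sum.cong[OF refl])
      fix u assume u: "u \<in> S \<rightarrow>\<^sub>E {..<n}"
      show "(\<Prod>i\<in>S. A $$ (v i, u i)) * (if word_monom S u = word_monom S w then 1 else 0) =
        (if u = restrict w S then \<Prod>i\<in>S. A $$ (v i, w i) else 0)"
      proof (cases "u = restrict w S")
        case True
        then have "word_monom S u = word_monom S w" by (auto intro: word_monom_cong)
        then show ?thesis using True by simp
      next
        case False
        then have "word_monom S u \<noteq> word_monom S w"
          using word_monom_inject[OF fin, of u w] PiE_restrict[OF u] by (metis restrict_ext)
        then show ?thesis using False by simp
      qed
    qed
    also have "\<dots> = (\<Prod>i\<in>S. A $$ (v i, w i))"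
      using finP w by (auto simp: restrict_PiE_iff)
    finally show ?thesis .
  qed
  have "lookup (act n A p) (word_monom S w) =
      (\<Sum>t\<in>keys p. lookup p t * lookup (subst_monom s t) (word_monom S w))"
    unfolding act_def s_def[symmetric] subst_def subst_monom_def[symmetric]
    by (simp add: lookup_sum lookup_Const_mult)
  also have "\<dots> = (\<Sum>t\<in>keys p \<union> word_monom S ` (S \<rightarrow>\<^sub>E {..<n}).
      lookup p t * lookup (subst_monom s t) (word_monom S w))"
    by (rule sum.mono_neutral_left) (auto simp: finP in_keys_iff)
  also have "\<dots> = (\<Sum>t\<in>word_monom S ` (S \<rightarrow>\<^sub>E {..<n}).
      lookup p t * lookup (subst_monom s t) (word_monom S w))"
    by (rule sum.mono_neutral_right) (auto simp: finP zero)
  also have "\<dots> = (\<Sum>v\<in>S \<rightarrow>\<^sub>E {..<n}. lookup p (word_monom S v) * (\<Prod>i\<in>S. A $$ (v i, w i)))"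
  proof -
    have "inj_on (word_monom S) (S \<rightarrow>\<^sub>E {..<n})"
      by (rule inj_onI, erule PiE_ext, assumption) (metis word_monom_inject[OF fin])
    then show ?thesis by (subst sum.reindex) (auto simp: one)
  qed
  finally show ?thesis .
qed


section \<open>Sums over partial matchings\<close>

text \<open>A permutation lists d single points, followed by l pairs, the i-th pair occupying the positions
  d + 2i and d + 2i + 1. Only the order inside the pairs is normalised here; in this form the sum
  over all pairings is easy to transform. Normalising the order of the pairs too, as sorted pairings
  do, leaves one permutation for each choice of a sequence of single points and a set of pairs.\<close>

definition pairing :: "nat \<Rightarrow> nat \<Rightarrow> (nat \<Rightarrow> nat) set" where
  "pairing d l = {\<rho>. \<rho> permutes {..<d + 2 * l} \<and> (\<forall>i<l. \<rho> (d + 2 * i) < \<rho> (d + 2 * i + 1))}"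

definition sorted_pairing :: "nat \<Rightarrow> nat \<Rightarrow> (nat \<Rightarrow> nat) set" where
  "sorted_pairing d l = {\<rho> \<in> pairing d l. strict_mono_on {..<l} (\<lambda>i. \<rho> (d + 2 * i))}"

definition pairing_term ::
  "nat \<Rightarrow> nat \<Rightarrow> (nat \<Rightarrow> nat \<Rightarrow> 'a::comm_ring_1) \<Rightarrow> (nat \<Rightarrow> nat \<Rightarrow> 'a) \<Rightarrow> (nat \<Rightarrow> nat) \<Rightarrow> 'a" where
  "pairing_term d l a b \<rho> = of_int (sign \<rho>) * (\<Prod>k<d. a k (\<rho> k)) *
     (\<Prod>i<l. b (\<rho> (d + 2 * i)) (\<rho> (d + 2 * i + 1)))"

text \<open>For d = 0 this is the Pfaffian of the skew-symmetric matrix with the entries b above the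
  diagonal. In general it is, up to sign, the Pfaffian of the matrix obtained by bordering that one
  with the d rows of a and a zero block.\<close>

definition pairing_sum :: "nat \<Rightarrow> nat \<Rightarrow> (nat \<Rightarrow> nat \<Rightarrow> 'a::comm_ring_1) \<Rightarrow> (nat \<Rightarrow> nat \<Rightarrow> 'a) \<Rightarrow> 'a" where
  "pairing_sum d l a b = (\<Sum>\<rho>\<in>sorted_pairing d l. pairing_term d l a b \<rho>)"

lemma finite_pairing [simp]: "finite (pairing d l)"
  unfolding pairing_def by (rule finite_subset[OF _ finite_permutations[of "{..<d + 2 * l}"]]) auto

lemma finite_sorted_pairing [simp]: "finite (sorted_pairing d l)"
  unfolding sorted_pairing_def by simp

lemma pairing_lt: "\<rho> permutes {..<(N::nat)} \<Longrightarrow> k < N \<Longrightarrow> \<rho> k < N"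
  using permutes_in_image[of \<rho> "{..<N}" k] by simp

lemma pairing_sum_cong:
  assumes "\<And>k i. k < d \<Longrightarrow> i < d + 2 * l \<Longrightarrow> a k i = a' k i"
    and "\<And>i j. i < d + 2 * l \<Longrightarrow> j < d + 2 * l \<Longrightarrow> b i j = b' i j"
  shows "pairing_sum d l a b = pairing_sum d l a' b'"
  unfolding pairing_sum_def
proof (rule sum.cong[OF refl])
  fix \<rho> assume "\<rho> \<in> sorted_pairing d l"
  then have "\<rho> permutes {..<d + 2 * l}" by (simp add: sorted_pairing_def pairing_def)
  then show "pairing_term d l a b \<rho> = pairing_term d l a' b' \<rho>"
    unfolding pairing_term_def by (simp add: assms pairing_lt)
qed

lemma (in comm_ring_hom) hom_pairing_sum:
  "hom (pairing_sum d l a b) = pairing_sum d l (\<lambda>k i. hom (a k i)) (\<lambda>i j. hom (b i j))"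
proof -
  have "hom (of_int k) = of_int k" for k
    by (cases k) (auto simp: hom_distribs)
  then show ?thesis
    by (simp add: pairing_sum_def pairing_term_def hom_distribs)
qed

subsection \<open>Permuting the pairs\<close>

definition block_perm :: "nat \<Rightarrow> (nat \<Rightarrow> nat) \<Rightarrow> nat \<Rightarrow> nat" where
  "block_perm d \<kappa> x = (if x < d then x else d + 2 * \<kappa> ((x - d) div 2) + (x - d) mod 2)"

lemma block_perm_low [simp]: "x < d \<Longrightarrow> block_perm d \<kappa> x = x"
  by (simp add: block_perm_def)

lemma block_perm_fst [simp]: "block_perm d \<kappa> (d + 2 * i) = d + 2 * \<kappa> i"
  by (simp add: block_perm_def)

lemma block_perm_snd [simp]: "block_perm d \<kappa> (Suc (d + 2 * i)) = Suc (d + 2 * \<kappa> i)"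
  by (simp add: block_perm_def)

lemma slot_cases:
  fixes x d :: nat
  obtains (low) "x < d" | (fst) i where "x = d + 2 * i" | (snd) i where "x = Suc (d + 2 * i)"
proof (cases "x < d")
  case False
  then obtain y where y: "x = d + y" using le_iff_add[of d x] by auto
  show ?thesis using that(2)[of "y div 2"] that(3)[of "y div 2"] y by (cases "even y") auto
qed (use that in auto)

lemma block_perm_comp: "block_perm d (\<kappa> \<circ> \<kappa>') = block_perm d \<kappa> \<circ> block_perm d \<kappa>'"
proof
  show "block_perm d (\<kappa> \<circ> \<kappa>') x = (block_perm d \<kappa> \<circ> block_perm d \<kappa>') x" for x
    by (cases rule: slot_cases[of x d]) auto
qed

lemma block_perm_id: "block_perm d id = id"
proof
  show "block_perm d id x = id x" for x by (cases rule: slot_cases[of x d]) auto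
qed

lemma block_perm_permutes:
  assumes "\<kappa> permutes {..<l}"
  shows "block_perm d \<kappa> permutes {..<d + 2 * l}"
proof -
  have "block_perm d \<kappa> \<circ> block_perm d (inv_into UNIV \<kappa>) = id" "block_perm d (inv_into UNIV \<kappa>) \<circ> block_perm d \<kappa> = id"
    using assms by (simp_all add: permutes_inv_o block_perm_id flip: block_perm_comp)
  then have "bij (block_perm d \<kappa>)" using o_bij by blast
  moreover have "block_perm d \<kappa> x = x" if "x \<notin> {..<d + 2 * l}" for x
    using that permutes_not_in[OF assms] by (cases rule: slot_cases[of x d]) auto
  ultimately show ?thesis unfolding permutes_def bij_def by (metis bij_iff bij_def \<open>bij (block_perm d \<kappa>)\<close>)
qed

lemma block_perm_transpose:
  "block_perm d (transpose a b) =
     transpose (d + 2 * a) (d + 2 * b) \<circ> transpose (Suc (d + 2 * a)) (Suc (d + 2 * b))"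
proof
  show "block_perm d (transpose a b) x =
     (transpose (d + 2 * a) (d + 2 * b) \<circ> transpose (Suc (d + 2 * a)) (Suc (d + 2 * b))) x" for x
    by (cases rule: slot_cases[of x d]) (auto simp: transpose_def)
qed

text \<open>Each transposition of two pairs is a product of two transpositions.\<close>

lemma sign_block_perm:
  assumes "\<kappa> permutes {..<l}"
  shows "sign (block_perm d \<kappa>) = 1"
  using assms finite_lessThan[of l]
proof (induction rule: permutes_induct)
  case id
  show ?case unfolding block_perm_id by (rule sign_id)
next
  case (swap a b p)
  have "permutation (block_perm d p)"
    using block_perm_permutes[OF \<open>p permutes {..<l}\<close>] by (auto simp: permutation_permutes)
  then show ?case
    using swap unfolding block_perm_comp block_perm_transpose
    by (subst sign_compose | simp add: sign_compose permutation_compose permutation_swap_id sign_swap_id)+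
qed

lemma pairing_permutation: "\<rho> \<in> pairing d l \<Longrightarrow> permutation \<rho>"
  by (auto simp: pairing_def permutation_permutes)

lemma pairing_block_perm:
  assumes "\<rho> \<in> pairing d l" "\<kappa> permutes {..<l}"
  shows "\<rho> \<circ> block_perm d \<kappa> \<in> pairing d l"
  using assms block_perm_permutes[OF assms(2), of d] permutes_in_image[OF assms(2)]
  by (auto simp: pairing_def intro: permutes_compose)

lemma pairing_term_block_perm:
  assumes "\<rho> \<in> pairing d l" "\<kappa> permutes {..<l}"
  shows "pairing_term d l a b (\<rho> \<circ> block_perm d \<kappa>) = pairing_term d l a b \<rho>"
proof -
  have "permutation (block_perm d \<kappa>)"
    using block_perm_permutes[OF assms(2), of d] by (auto simp: permutation_permutes)
  then have "sign (\<rho> \<circ> block_perm d \<kappa>) = sign \<rho>"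
    using pairing_permutation[OF assms(1)] by (simp add: sign_compose sign_block_perm[OF assms(2)])
  moreover have "(\<Prod>i<l. b (\<rho> (d + 2 * i)) (\<rho> (d + 2 * i + 1))) =
      (\<Prod>i<l. b (\<rho> (d + 2 * \<kappa> i)) (\<rho> (d + 2 * \<kappa> i + 1)))"
    using prod.permute[OF assms(2), of "\<lambda>i. b (\<rho> (d + 2 * i)) (\<rho> (d + 2 * i + 1))"] by (simp add: o_def)
  ultimately show ?thesis by (simp add: pairing_term_def)
qed

text \<open>Together with the next lemma: a finite sequence of distinct numbers is sorted by exactly one
  permutation.\<close>

lemma sorting_exists:
  fixes f :: "nat \<Rightarrow> nat"
  assumes "inj_on f {..<l}"
  shows "\<exists>\<kappa>. \<kappa> permutes {..<l} \<and> strict_mono_on {..<l} (f \<circ> \<kappa>)"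
proof -
  define xs where "xs = sorted_list_of_set (f ` {..<l})"
  have len: "length xs = l" using assms by (simp add: xs_def card_image)
  have set: "set xs = f ` {..<l}" by (simp add: xs_def)
  have sorted: "sorted_wrt (<) xs" by (simp add: xs_def)
  define \<kappa> where "\<kappa> i = (if i < l then inv_into {..<l} f (xs ! i) else i)" for i
  have mem: "xs ! i \<in> f ` {..<l}" if "i < l" for i using that set len nth_mem by metis
  have f\<kappa>: "f (\<kappa> i) = xs ! i" if "i < l" for i
    using f_inv_into_f[OF mem[OF that]] that by (simp add: \<kappa>_def)
  have "inj_on \<kappa> {..<l}"
    using f\<kappa> len by (intro inj_onI) (metis distinct_sorted_list_of_set lessThan_iff nth_eq_iff_index_eq xs_def)
  moreover have "\<kappa> ` {..<l} \<subseteq> {..<l}"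
    using inv_into_into[OF mem] by (auto simp: \<kappa>_def)
  ultimately have "bij_betw \<kappa> {..<l} {..<l}"
    by (simp add: bij_betw_def endo_inj_surj)
  then have "\<kappa> permutes {..<l}"
    by (rule bij_imp_permutes) (simp add: \<kappa>_def)
  moreover have "strict_mono_on {..<l} (f \<circ> \<kappa>)"
    using sorted len by (intro strict_mono_onI) (simp add: f\<kappa> sorted_wrt_nth_less)
  ultimately show ?thesis by blast
qed

lemma sorted_unique:
  fixes f g :: "nat \<Rightarrow> nat"
  assumes f: "strict_mono_on {p..<q} f" and g: "strict_mono_on {p..<q} g"
    and im: "f ` {p..<q} = g ` {p..<q}" and i: "i \<in> {p..<q}"
  shows "f i = g i"
proof -
  have *: "sorted_wrt (<) (map h [p..<q])" if "strict_mono_on {p..<q} h" for h :: "nat \<Rightarrow> nat"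
    using that by (auto simp: sorted_wrt_iff_nth_less intro!: strict_mono_onD[OF that])
  have "map f [p..<q] = map g [p..<q]"
    by (rule strict_sorted_equal[OF *[OF g] *[OF f]]) (use im in auto)
  then show ?thesis using i by auto
qed

text \<open>Every pairing arises from exactly one sorted pairing by permuting the pairs, so that dropping
  the order of the pairs multiplies the sum by the order of the symmetric group.\<close>

lemma sum_pairing: "(\<Sum>\<rho>\<in>pairing d l. pairing_term d l a b \<rho>) = of_nat (fact l) * pairing_sum d l a b"
proof -
  let ?P = "{\<kappa>. \<kappa> permutes {..<l}}"
  let ?h = "\<lambda>(\<rho>, \<kappa>). \<rho> \<circ> block_perm d \<kappa>"
  have inj: "inj_on ?h (sorted_pairing d l \<times> ?P)"
  proof (rule inj_onI, clarify)
    fix \<rho> \<rho>' \<kappa> \<kappa>'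
    assume \<rho>: "\<rho> \<in> sorted_pairing d l" and \<rho>': "\<rho>' \<in> sorted_pairing d l"
      and \<kappa>: "\<kappa> permutes {..<l}" and \<kappa>': "\<kappa>' permutes {..<l}"
      and eq: "\<rho> \<circ> block_perm d \<kappa> = \<rho>' \<circ> block_perm d \<kappa>'"
    have eq1: "\<rho> (d + 2 * \<kappa> i) = \<rho>' (d + 2 * \<kappa>' i)" for i
      using fun_cong[OF eq, of "d + 2 * i"] by simp
    have im: "(\<lambda>i. \<rho> (d + 2 * i)) ` {..<l} = (\<lambda>i. \<rho>' (d + 2 * i)) ` {..<l}"
    proof -
      have "(\<lambda>i. \<rho> (d + 2 * i)) ` {..<l} = (\<lambda>i. \<rho> (d + 2 * i)) ` \<kappa> ` {..<l}"
        using permutes_image[OF \<kappa>] by simp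
      also have "\<dots> = (\<lambda>i. \<rho>' (d + 2 * i)) ` \<kappa>' ` {..<l}" by (simp add: image_image eq1)
      finally show ?thesis using permutes_image[OF \<kappa>'] by simp
    qed
    have f: "\<rho> (d + 2 * i) = \<rho>' (d + 2 * i)" if "i < l" for i
      using sorted_unique[of 0 l "\<lambda>i. \<rho> (d + 2 * i)" "\<lambda>i. \<rho>' (d + 2 * i)" i] \<rho> \<rho>' im that
      by (auto simp: sorted_pairing_def atLeast0LessThan)
    have inj': "inj \<rho>'" using \<rho>' permutes_inj by (auto simp: sorted_pairing_def pairing_def)
    have "\<kappa> = \<kappa>'"
    proof
      fix i
      show "\<kappa> i = \<kappa>' i"
      proof (cases "i < l")
        case True
        then have "\<kappa> i < l" using pairing_lt[OF \<kappa>] by simp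
        then have "\<rho>' (d + 2 * \<kappa> i) = \<rho>' (d + 2 * \<kappa>' i)" using f eq1[of i] by simp
        then show ?thesis using injD[OF inj'] by fastforce
      qed (use permutes_not_in[OF \<kappa>] permutes_not_in[OF \<kappa>'] in auto)
    qed
    moreover have "\<rho> = \<rho>'"
    proof -
      have "surj (block_perm d \<kappa>)" using block_perm_permutes[OF \<kappa>, of d] permutes_surj by blast
      then show ?thesis using eq \<open>\<kappa> = \<kappa>'\<close> by (metis (no_types, lifting) comp_apply ext surj_def)
    qed
    ultimately show "\<rho> = \<rho>' \<and> \<kappa> = \<kappa>'" by simp
  qed
  have surj: "?h ` (sorted_pairing d l \<times> ?P) = pairing d l"
  proof
    show "?h ` (sorted_pairing d l \<times> ?P) \<subseteq> pairing d l"
      using pairing_block_perm by (auto simp: sorted_pairing_def)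
    show "pairing d l \<subseteq> ?h ` (sorted_pairing d l \<times> ?P)"
    proof
      fix \<rho> assume \<rho>: "\<rho> \<in> pairing d l"
      then have "inj \<rho>" using permutes_inj by (auto simp: pairing_def)
      then have "inj_on (\<lambda>i. \<rho> (d + 2 * i)) {..<l}" by (fastforce intro: inj_onI dest: injD)
      then obtain \<kappa> where \<kappa>: "\<kappa> permutes {..<l}"
          and mono: "strict_mono_on {..<l} ((\<lambda>i. \<rho> (d + 2 * i)) \<circ> \<kappa>)"
        using sorting_exists by blast
      have "\<rho> \<circ> block_perm d \<kappa> \<in> sorted_pairing d l"
        using pairing_block_perm[OF \<rho> \<kappa>] mono by (simp add: sorted_pairing_def o_def)
      moreover have "\<rho> = ?h (\<rho> \<circ> block_perm d \<kappa>, inv_into UNIV \<kappa>)"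
        using permutes_inv_o(1)[OF \<kappa>] by (simp add: o_assoc[symmetric] block_perm_id flip: block_perm_comp)
      ultimately show "\<rho> \<in> ?h ` (sorted_pairing d l \<times> ?P)"
        using permutes_inv[OF \<kappa>] by blast
    qed
  qed
  have "(\<Sum>\<rho>\<in>pairing d l. pairing_term d l a b \<rho>) =
      (\<Sum>(\<rho>, \<kappa>)\<in>sorted_pairing d l \<times> ?P. pairing_term d l a b (\<rho> \<circ> block_perm d \<kappa>))"
    unfolding surj[symmetric] by (subst sum.reindex[OF inj]) (simp add: case_prod_beta o_def)
  also have "\<dots> = (\<Sum>(\<rho>, \<kappa>)\<in>sorted_pairing d l \<times> ?P. pairing_term d l a b \<rho>)"
    by (rule sum.cong) (auto simp: pairing_term_block_perm sorted_pairing_def)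
  also have "\<dots> = of_nat (fact l) * pairing_sum d l a b"
    by (simp add: sum.cartesian_product[symmetric] pairing_sum_def sum_distrib_left card_permutations)
  finally show ?thesis .
qed

subsection \<open>Exchanging two adjacent arguments\<close>

text \<open>The permutation that moves the last two positions m, m + 1 to i, i + 1 and preserves the
  order of the other ones. It is the square of a cycle, hence even.\<close>

definition gap_perm :: "nat \<Rightarrow> nat \<Rightarrow> nat \<Rightarrow> nat" where
  "gap_perm i m k = (if k < i then k else if k < m then k + 2 else if k = m then i
     else if k = m + 1 then i + 1 else k)"

lemma gap_perm_permutes:
  assumes "i \<le> m"
  shows "gap_perm i m permutes {..<m + 2}" and "sign (gap_perm i m) = 1"
proof -
  \<comment> \<open>The cycle that moves only the last position, m + 1, to i.\<close>
  define c where "c k = (if k < i then k else if k \<le> m then k + 1 else if k = m + 1 then i else k)" for k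
  have "inj_on c {..<m + 2}" by (auto simp: inj_on_def c_def)
  moreover have "c ` {..<m + 2} \<subseteq> {..<m + 2}" using assms by (auto simp: c_def)
  ultimately have "bij_betw c {..<m + 2} {..<m + 2}"
    by (simp add: bij_betw_def endo_inj_surj)
  then have c: "c permutes {..<m + 2}"
    by (rule bij_imp_permutes) (auto simp: c_def)
  have gap: "gap_perm i m = c \<circ> c"
    using assms by (auto simp: gap_perm_def c_def fun_eq_iff)
  show "gap_perm i m permutes {..<m + 2}" unfolding gap using permutes_compose[OF c c] .
  have "permutation c" using c by (auto simp: permutation_permutes)
  then show "sign (gap_perm i m) = 1" unfolding gap by (simp add: sign_compose)
qed

lemma gap_perm_mono: "j < k \<Longrightarrow> k < m \<Longrightarrow> gap_perm i m j < gap_perm i m k"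
  by (auto simp: gap_perm_def)

text \<open>Composition with the gap permutation identifies the pairings of the remaining points with the
  pairings whose last pair is i, i + 1, because it preserves order and sign.\<close>

lemma sum_pairing_gap:
  assumes i: "i \<le> d + 2 * l"
  shows "(\<Sum>\<rho> | \<rho> \<in> pairing d (Suc l) \<and> \<rho> (d + 2 * l) = i \<and> \<rho> (d + 2 * l + 1) = i + 1.
       pairing_term d (Suc l) a b \<rho>) =
     b i (i + 1) * (\<Sum>\<rho>\<in>pairing d l. pairing_term d l
       (\<lambda>k x. a k (gap_perm i (d + 2 * l) x)) (\<lambda>x y. b (gap_perm i (d + 2 * l) x) (gap_perm i (d + 2 * l) y)) \<rho>)"
proof -
  let ?m = "d + 2 * l"
  let ?g = "gap_perm i ?m"
  note g = gap_perm_permutes[OF i]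
  have gperm: "permutation ?g" using g(1) by (auto simp: permutation_permutes)
  have bij: "bij_betw (\<lambda>\<rho>. ?g \<circ> \<rho>) (pairing d l)
     {\<rho> \<in> pairing d (Suc l). \<rho> ?m = i \<and> \<rho> (?m + 1) = i + 1}" (is "bij_betw _ _ ?T")
  proof (rule bij_betw_byWitness[where f' = "\<lambda>\<rho>. inv_into UNIV ?g \<circ> \<rho>"])
    show "\<forall>\<rho>\<in>pairing d l. inv_into UNIV ?g \<circ> (?g \<circ> \<rho>) = \<rho>"
      by (simp add: o_assoc permutes_inv_o(2)[OF g(1)])
    show "\<forall>\<rho>\<in>?T. ?g \<circ> (inv_into UNIV ?g \<circ> \<rho>) = \<rho>"
      by (simp add: o_assoc permutes_inv_o(1)[OF g(1)])
    show "(\<lambda>\<rho>. ?g \<circ> \<rho>) ` pairing d l \<subseteq> ?T"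
    proof clarify
      fix \<rho> assume \<rho>: "\<rho> \<in> pairing d l"
      then have p: "\<rho> permutes {..<?m}" by (simp add: pairing_def)
      have "\<rho> permutes {..<?m + 2}" by (rule permutes_subset[OF p]) auto
      then have "?g \<circ> \<rho> permutes {..<?m + 2}" using g(1) by (rule permutes_compose)
      moreover have "\<rho> ?m = ?m" "\<rho> (?m + 1) = ?m + 1" using permutes_not_in[OF p] by auto
      moreover have "?g ?m = i" "?g (?m + 1) = i + 1" using i by (auto simp: gap_perm_def)
      moreover have "?g (\<rho> (d + 2 * j)) < ?g (\<rho> (d + 2 * j + 1))" if "j < l" for j
        using \<rho> that pairing_lt[OF p, of "d + 2 * j + 1"] by (intro gap_perm_mono) (auto simp: pairing_def)
      ultimately show "?g \<circ> \<rho> \<in> pairing d (Suc l) \<and> (?g \<circ> \<rho>) ?m = i \<and> (?g \<circ> \<rho>) (?m + 1) = i + 1"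
        by (auto simp: pairing_def less_Suc_eq)
    qed
    show "(\<lambda>\<rho>. inv_into UNIV ?g \<circ> \<rho>) ` ?T \<subseteq> pairing d l"
    proof (rule image_subsetI)
      fix \<rho> assume "\<rho> \<in> ?T"
      then have \<rho>: "\<rho> \<in> pairing d (Suc l)" and r: "\<rho> ?m = i" "\<rho> (?m + 1) = i + 1" by auto
      have p: "\<rho> permutes {..<?m + 2}" using \<rho> by (simp add: pairing_def)
      have gm: "?g ?m = i" "?g (?m + 1) = i + 1" using i by (auto simp: gap_perm_def)
      have fixed: "(inv_into UNIV ?g \<circ> \<rho>) ?m = ?m" "(inv_into UNIV ?g \<circ> \<rho>) (?m + 1) = ?m + 1"
        using r gm permutes_inv_eq[OF g(1)] by auto
      have "inv_into UNIV ?g \<circ> \<rho> permutes {..<?m + 2}"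
        using p permutes_inv[OF g(1)] by (rule permutes_compose)
      then have p': "inv_into UNIV ?g \<circ> \<rho> permutes {..<?m}"
        by (rule permutes_superset) (use fixed in \<open>auto simp: less_Suc_eq\<close>)
      moreover have "(inv_into UNIV ?g \<circ> \<rho>) (d + 2 * j) < (inv_into UNIV ?g \<circ> \<rho>) (d + 2 * j + 1)" if j: "j < l" for j
      proof (rule ccontr)
        let ?x = "(inv_into UNIV ?g \<circ> \<rho>) (d + 2 * j)" and ?y = "(inv_into UNIV ?g \<circ> \<rho>) (d + 2 * j + 1)"
        assume "\<not> ?x < ?y"
        moreover have "?x \<noteq> ?y" using permutes_inj[OF p'] by (metis add_cancel_left_right injD zero_neq_one)
        ultimately have "?y < ?x" by simp
        then have "?g ?y < ?g ?x"
          using pairing_lt[OF p', of "d + 2 * j"] j by (intro gap_perm_mono) auto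
        then have "\<rho> (d + 2 * j + 1) < \<rho> (d + 2 * j)"
          using permutes_inverses(1)[OF g(1)] by simp
        moreover have "\<rho> (d + 2 * j) < \<rho> (d + 2 * j + 1)" using \<rho> j by (simp add: pairing_def)
        ultimately show False by simp
      qed
      ultimately show "inv_into UNIV ?g \<circ> \<rho> \<in> pairing d l" by (simp add: pairing_def)
    qed
  qed
  have factor: "pairing_term d (Suc l) a b (?g \<circ> \<rho>) = b i (i + 1) *
      pairing_term d l (\<lambda>k x. a k (?g x)) (\<lambda>x y. b (?g x) (?g y)) \<rho>" if \<rho>: "\<rho> \<in> pairing d l" for \<rho>
  proof -
    have p: "\<rho> permutes {..<?m}" using \<rho> by (simp add: pairing_def)
    have "?g (\<rho> ?m) = i" "?g (\<rho> (Suc ?m)) = i + 1"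
      using i permutes_not_in[OF p, of ?m] permutes_not_in[OF p, of "Suc ?m"] by (auto simp: gap_perm_def)
    then show ?thesis
      using pairing_permutation[OF \<rho>] gperm g(2) by (simp add: pairing_term_def sign_compose mult_ac)
  qed
  show ?thesis
    using sum.reindex_bij_betw[OF bij, of "pairing_term d (Suc l) a b"]
    by (simp add: factor sum_distrib_left)
qed

text \<open>Composition with the transposition t of i and i + 1 changes the sign of a permutation, and it
  preserves the order inside all pairs except a pair i, i + 1. So the pairings without this pair cancel
  between the two sums. A pairing with this pair has the same term in both sums, since b is
  symmetric, and the l + 1 possible positions of the pair contribute equally.\<close>

lemma sum_pairing_transpose:
  fixes a b :: "nat \<Rightarrow> nat \<Rightarrow> 'a::comm_ring_1"
  assumes i: "i \<le> d + 2 * l" and sym: "\<And>x y. b x y = b y x"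
  defines "t \<equiv> transpose i (i + 1)" and "g \<equiv> gap_perm i (d + 2 * l)"
  shows "(\<Sum>\<rho>\<in>pairing d (Suc l). pairing_term d (Suc l) (\<lambda>k x. a k (t x)) (\<lambda>x y. b (t x) (t y)) \<rho>) +
      (\<Sum>\<rho>\<in>pairing d (Suc l). pairing_term d (Suc l) a b \<rho>) =
     2 * of_nat (Suc l) * b i (i + 1) *
       (\<Sum>\<rho>\<in>pairing d l. pairing_term d l (\<lambda>k x. a k (g x)) (\<lambda>x y. b (g x) (g y)) \<rho>)"
proof -
  define a' b' where "a' = (\<lambda>k x. a k (t x))" and "b' = (\<lambda>x y. b (t x) (t y))"
  let ?m = "d + 2 * l"
  let ?P = "pairing d (Suc l)"
  let ?f = "pairing_term d (Suc l) a b" and ?f' = "pairing_term d (Suc l) a' b'"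
  define Q where "Q s = {\<rho> \<in> ?P. \<rho> (d + 2 * s) = i \<and> \<rho> (d + 2 * s + 1) = i + 1}" for s
  define P1 where "P1 = (\<Union>s\<in>{..<Suc l}. Q s)"
  have fin: "finite P1" "P1 \<subseteq> ?P" "finite (Q s)" for s by (auto simp: P1_def Q_def)
  have tt: "t (t x) = x" for x by (simp add: t_def)
  have tperm: "t permutes {..<?m + 2}" unfolding t_def by (rule permutes_swap_id) (use i in auto)
  have tlt: "t x < t y" if "x < y" "\<not> (x = i \<and> y = i + 1)" for x y
    using that by (auto simp: t_def transpose_def)
  have invol: "t \<circ> \<rho> \<in> ?P - P1" if \<rho>: "\<rho> \<in> ?P - P1" for \<rho>
  proof -
    have ne: "\<not> (\<rho> (d + 2 * s) = i \<and> \<rho> (d + 2 * s + 1) = i + 1)" if "s < Suc l" for s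
      using \<rho> that by (auto simp: P1_def Q_def)
    have lt: "\<rho> (d + 2 * s) < \<rho> (d + 2 * s + 1)" if "s < Suc l" for s
      using \<rho> that by (simp add: pairing_def)
    have "t \<circ> \<rho> permutes {..<?m + 2}"
      using \<rho> tperm by (auto simp: pairing_def intro: permutes_compose)
    then have "t \<circ> \<rho> \<in> ?P"
      using tlt[OF lt ne] by (simp add: pairing_def)
    moreover have "t \<circ> \<rho> \<notin> Q s" if s: "s < Suc l" for s
    proof
      assume "t \<circ> \<rho> \<in> Q s"
      then have "t (\<rho> (d + 2 * s)) = i" "t (\<rho> (d + 2 * s + 1)) = i + 1" by (auto simp: Q_def)
      then have "\<rho> (d + 2 * s) = t i" "\<rho> (d + 2 * s + 1) = t (i + 1)" using tt by metis+
      then show False using lt[OF s] by (simp add: t_def)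
    qed
    ultimately show ?thesis by (auto simp: P1_def)
  qed
  have neg: "?f' \<rho> = - ?f (t \<circ> \<rho>)" if "\<rho> \<in> ?P" for \<rho>
  proof -
    have "sign (t \<circ> \<rho>) = - sign \<rho>"
      using pairing_permutation[OF that] by (simp add: t_def sign_compose permutation_swap_id sign_swap_id)
    then show ?thesis by (simp add: pairing_term_def a'_def b'_def)
  qed
  have "(\<Sum>\<rho>\<in>?P - P1. ?f (t \<circ> \<rho>)) = (\<Sum>\<rho>\<in>?P - P1. ?f \<rho>)"
    by (rule sum.reindex_bij_witness[where i = "\<lambda>\<rho>. t \<circ> \<rho>" and j = "\<lambda>\<rho>. t \<circ> \<rho>"])
       (use invol in \<open>auto simp: fun_eq_iff tt\<close>)
  then have cancel: "(\<Sum>\<rho>\<in>?P - P1. ?f' \<rho>) + (\<Sum>\<rho>\<in>?P - P1. ?f \<rho>) = 0"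
    by (simp add: neg sum_negf)
  have same: "?f' \<rho> = ?f \<rho>" if \<rho>: "\<rho> \<in> P1" for \<rho>
  proof -
    obtain s where s: "s < Suc l" "\<rho> \<in> Q s" using \<rho> by (auto simp: P1_def)
    then have r: "\<rho> (d + 2 * s) = i" "\<rho> (d + 2 * s + 1) = i + 1" and \<rho>P: "\<rho> \<in> ?P" by (auto simp: Q_def)
    have inj: "inj \<rho>" using \<rho>P permutes_inj by (auto simp: pairing_def)
    have tid: "t (\<rho> x) = \<rho> x" if "x \<noteq> d + 2 * s" "x \<noteq> d + 2 * s + 1" for x
    proof -
      have "\<rho> x \<noteq> i" "\<rho> x \<noteq> i + 1" using that inj r by (metis injD)+
      then show ?thesis by (simp add: t_def)
    qed
    have "(\<Prod>k<d. a' k (\<rho> k)) = (\<Prod>k<d. a k (\<rho> k))"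
      by (rule prod.cong) (auto simp: a'_def tid)
    moreover have "b' (\<rho> (d + 2 * j)) (\<rho> (d + 2 * j + 1)) = b (\<rho> (d + 2 * j)) (\<rho> (d + 2 * j + 1))" for j
    proof (cases "j = s")
      case True
      then show ?thesis using r sym by (simp add: b'_def t_def)
    next
      case False
      then have "t (\<rho> (d + 2 * j)) = \<rho> (d + 2 * j)" "t (\<rho> (d + 2 * j + 1)) = \<rho> (d + 2 * j + 1)"
        by (intro tid; presburger)+
      then show ?thesis by (simp add: b'_def)
    qed
    ultimately show ?thesis by (simp add: pairing_term_def)
  qed
  have disj: "Q s \<inter> Q s' = {}" if "s \<noteq> s'" for s s'
  proof -
    have False if "\<rho> \<in> Q s" "\<rho> \<in> Q s'" for \<rho>
    proof -
      have "inj \<rho>" using that permutes_inj by (auto simp: Q_def pairing_def)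
      then show False using that \<open>s \<noteq> s'\<close> by (auto simp: Q_def dest!: injD)
    qed
    then show ?thesis by blast
  qed
  \<comment> \<open>Exchanging two pairs moves the pair i, i + 1 to the last position.\<close>
  have slot: "(\<Sum>\<rho>\<in>Q s. ?f \<rho>) = (\<Sum>\<rho>\<in>Q l. ?f \<rho>)" if s: "s < Suc l" for s
  proof -
    let ?k = "transpose s l"
    have k: "?k permutes {..<Suc l}" by (rule permutes_swap_id) (use s in auto)
    have kk: "block_perm d ?k \<circ> block_perm d ?k = id"
      by (simp add: block_perm_id flip: block_perm_comp)
    show ?thesis
    proof (rule sum.reindex_bij_witness[where i = "\<lambda>\<rho>. \<rho> \<circ> block_perm d ?k" and j = "\<lambda>\<rho>. \<rho> \<circ> block_perm d ?k"])
      fix \<rho> :: "nat \<Rightarrow> nat"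
      show "\<rho> \<circ> block_perm d ?k \<circ> block_perm d ?k = \<rho>" by (simp add: o_assoc[symmetric] kk)
      then show "\<rho> \<circ> block_perm d ?k \<circ> block_perm d ?k = \<rho>" .
      show "\<rho> \<circ> block_perm d ?k \<in> Q l" if "\<rho> \<in> Q s"
        using that pairing_block_perm[OF _ k] by (auto simp: Q_def)
      show "\<rho> \<circ> block_perm d ?k \<in> Q s" if "\<rho> \<in> Q l"
        using that pairing_block_perm[OF _ k] by (auto simp: Q_def)
      show "?f (\<rho> \<circ> block_perm d ?k) = ?f \<rho>" if "\<rho> \<in> Q s"
        using that pairing_term_block_perm[OF _ k] by (auto simp: Q_def)
    qed
  qed
  have "(\<Sum>\<rho>\<in>P1. ?f \<rho>) = (\<Sum>s<Suc l. \<Sum>\<rho>\<in>Q s. ?f \<rho>)"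
    unfolding P1_def by (rule sum.UNION_disjoint) (use fin disj in auto)
  also have "\<dots> = of_nat (Suc l) * (\<Sum>\<rho>\<in>Q l. ?f \<rho>)"
    using sum.cong[OF refl slot, of "{..<Suc l}"] by simp
  also have "(\<Sum>\<rho>\<in>Q l. ?f \<rho>) = b i (i + 1) *
      (\<Sum>\<rho>\<in>pairing d l. pairing_term d l (\<lambda>k x. a k (g x)) (\<lambda>x y. b (g x) (g y)) \<rho>)"
    unfolding Q_def g_def using sum_pairing_gap[OF i, of a b] by (simp add: conj_ac)
  finally have P1: "(\<Sum>\<rho>\<in>P1. ?f \<rho>) = of_nat (Suc l) * (b i (i + 1) *
      (\<Sum>\<rho>\<in>pairing d l. pairing_term d l (\<lambda>k x. a k (g x)) (\<lambda>x y. b (g x) (g y)) \<rho>))" .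
  have "(\<Sum>\<rho>\<in>?P. ?f' \<rho>) + (\<Sum>\<rho>\<in>?P. ?f \<rho>) =
      ((\<Sum>\<rho>\<in>?P - P1. ?f' \<rho>) + (\<Sum>\<rho>\<in>?P - P1. ?f \<rho>)) + ((\<Sum>\<rho>\<in>P1. ?f' \<rho>) + (\<Sum>\<rho>\<in>P1. ?f \<rho>))"
    by (simp add: sum.subset_diff[OF fin(2) finite_pairing, of ?f'] sum.subset_diff[OF fin(2) finite_pairing, of ?f])
  also have "\<dots> = 2 * (\<Sum>\<rho>\<in>P1. ?f \<rho>)"
    using cancel by (simp add: same)
  finally show ?thesis unfolding P1 a'_def b'_def by (simp add: algebra_simps)
qed

text \<open>Over the integers the factorial that counts the orders of the pairs cancels. What
  remains is the relation u v + v u = 2 b(u,v) of a Clifford algebra.\<close>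

lemma pairing_sum_transpose:
  fixes a b :: "nat \<Rightarrow> nat \<Rightarrow> int"
  assumes i: "i \<le> d + 2 * l" and sym: "\<And>x y. b x y = b y x"
  defines "t \<equiv> transpose i (i + 1)" and "g \<equiv> gap_perm i (d + 2 * l)"
  shows "pairing_sum d (Suc l) (\<lambda>k x. a k (t x)) (\<lambda>x y. b (t x) (t y)) + pairing_sum d (Suc l) a b =
     2 * b i (i + 1) * pairing_sum d l (\<lambda>k x. a k (g x)) (\<lambda>x y. b (g x) (g y))"
proof -
  have "fact (Suc l) * (pairing_sum d (Suc l) (\<lambda>k x. a k (t x)) (\<lambda>x y. b (t x) (t y)) + pairing_sum d (Suc l) a b) =
     2 * of_nat (Suc l) * b i (i + 1) * (fact l * pairing_sum d l (\<lambda>k x. a k (g x)) (\<lambda>x y. b (g x) (g y)))"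
    using sum_pairing_transpose[where a = a and b = b, OF i sym] unfolding sum_pairing t_def g_def
    by (simp add: algebra_simps)
  also have "\<dots> = fact (Suc l) * (2 * b i (i + 1) * pairing_sum d l (\<lambda>k x. a k (g x)) (\<lambda>x y. b (g x) (g y)))"
    by simp
  finally show ?thesis by (simp only: mult_left_cancel[OF fact_nonzero])
qed


section \<open>Values on words\<close>

text \<open>The Gram matrix of the coordinate basis for the polarisation B of q, where B(v,v) = 2 q(v).\<close>

definition gram :: "nat \<Rightarrow> nat \<Rightarrow> nat \<Rightarrow> int" where
  "gram n k l = (if k = n - 1 \<or> l = n - 1 then (if k = l then 2 else 0)
     else if k \<noteq> l \<and> k div 2 = l div 2 then 1 else 0)"

lemma gram_sym: "gram n k l = gram n l k"
  by (auto simp: gram_def)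

definition word_value :: "nat \<Rightarrow> nat \<Rightarrow> nat \<Rightarrow> (nat \<Rightarrow> nat) \<Rightarrow> int" where
  "word_value n d l w = pairing_sum d l (\<lambda>k i. if w i = k then 1 else 0) (\<lambda>i j. gram n (w i) (w j))"

lemma word_value_cong: "(\<And>i. i < d + 2 * l \<Longrightarrow> v i = w i) \<Longrightarrow> word_value n d l v = word_value n d l w"
  unfolding word_value_def by (rule pairing_sum_cong) auto

lemma word_value_transpose:
  assumes "i \<le> d + 2 * l"
  shows "word_value n d (Suc l) (w \<circ> transpose i (i + 1)) + word_value n d (Suc l) w =
     2 * gram n (w i) (w (i + 1)) * word_value n d l (w \<circ> gap_perm i (d + 2 * l))"
  unfolding word_value_def
  using pairing_sum_transpose[OF assms, where b = "\<lambda>i j. gram n (w i) (w j)", OF gram_sym,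
      of "\<lambda>k i. if w i = k then 1 else 0"]
  by simp

lemma word_value_adjacent:
  assumes "i \<le> d + 2 * l" "w i = w (i + 1)"
  shows "word_value n d (Suc l) w = gram n (w i) (w i) * word_value n d l (w \<circ> gap_perm i (d + 2 * l))"
proof -
  have "w \<circ> transpose i (i + 1) = w"
    using assms(2) by (auto simp: fun_eq_iff transpose_def)
  then show ?thesis using word_value_transpose[OF assms(1), of n w] assms(2) by simp
qed

text \<open>Modulo 2^(e+1), exchanging adjacent letters changes the sign, so that two equal letters
  can be made adjacent; then the value is a multiple of an entry 0 or 2 of the Gram matrix.\<close>

lemma word_value_repeated:
  assumes dvd: "\<And>v. (\<And>i. v i < n) \<Longrightarrow> 2 ^ e dvd word_value n d l v"
    and w: "\<And>i. w i < n" and eq: "w i = w (i + Suc g)" and le: "i + g \<le> d + 2 * l"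
  shows "2 ^ Suc e dvd word_value n d (Suc l) w"
  using w eq le
proof (induction g arbitrary: w)
  case 0
  have "2 ^ e dvd word_value n d l (w \<circ> gap_perm i (d + 2 * l))" by (rule dvd) (simp add: 0)
  moreover have "2 dvd gram n (w i) (w i)" by (simp add: gram_def)
  ultimately show ?case using 0 by (simp add: word_value_adjacent mult_dvd_mono)
next
  case (Suc g)
  let ?j = "i + Suc g"
  let ?t = "transpose ?j (?j + 1)"
  have "2 ^ e dvd word_value n d l (w \<circ> gap_perm ?j (d + 2 * l))" by (rule dvd) (simp add: Suc)
  then have "2 ^ Suc e dvd 2 * gram n (w ?j) (w (?j + 1)) * word_value n d l (w \<circ> gap_perm ?j (d + 2 * l))"
    by (simp add: mult_dvd_mono)
  moreover have "2 ^ Suc e dvd word_value n d (Suc l) (w \<circ> ?t)"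
    by (rule Suc.IH) (use Suc.prems in \<open>auto simp: transpose_def\<close>)
  ultimately show ?case
    using word_value_transpose[of ?j d l n w] Suc.prems(3) by (metis dvd_add_right_iff)
qed

text \<open>The word has d + 2l letters, hence more than n when the exponent is positive, and one of them is
  repeated.\<close>

lemma word_value_dvd:
  assumes n: "odd n" and d: "d = 0 \<or> d = n" and w: "\<And>i. w i < n"
  shows "2 ^ ((d + 2 * l) div 2 - n div 2) dvd word_value n d l w"
  using w
proof (induction l arbitrary: w)
  case 0
  then show ?case using d by auto
next
  case (Suc l)
  show ?case
  proof (cases "(d + 2 * l) div 2 < n div 2")
    case True
    then show ?thesis by simp
  next
    case False
    have "n < d + 2 * Suc l" using False d n by (auto elim!: oddE)
    then have "\<not> inj_on w {..<d + 2 * Suc l}"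
      using card_inj_on_le[of w "{..<d + 2 * Suc l}" "{..<n}"] Suc.prems by (auto simp: image_subset_iff)
    then obtain x y where "x < d + 2 * Suc l" "y < d + 2 * Suc l" "x \<noteq> y" "w x = w y"
      by (auto simp: inj_on_def)
    then obtain i j where "i < j" "j < d + 2 * Suc l" "w i = w j"
      by (metis linorder_neqE_nat)
    moreover define g where "g = j - Suc i"
    ultimately have "w i = w (i + Suc g)" "i + g \<le> d + 2 * l" by auto
    then have "2 ^ Suc ((d + 2 * l) div 2 - n div 2) dvd word_value n d (Suc l) w"
      by (intro word_value_repeated Suc)
    moreover have "Suc ((d + 2 * l) div 2 - n div 2) = (d + 2 * Suc l) div 2 - n div 2"
      using False by simp
    ultimately show ?thesis by metis
  qed
qed

text \<open>Coordinates being numbered from 0, this is x_1 y_1 ... x_\<nu> y_\<nu> z ... z.\<close>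

definition standard_word :: "nat \<Rightarrow> nat \<Rightarrow> nat" where
  "standard_word n i = min i (n - 1)"

lemma word_value_standard_word_step:
  assumes "n - 1 \<le> d + 2 * l"
  shows "word_value n d (Suc l) (standard_word n) = 2 * word_value n d l (standard_word n)"
proof -
  let ?i = "d + 2 * l"
  have "word_value n d l (standard_word n \<circ> gap_perm ?i ?i) = word_value n d l (standard_word n)"
    by (rule word_value_cong) (simp add: gap_perm_def)
  then show ?thesis
    using word_value_adjacent[of ?i d l "standard_word n" n] assms by (simp add: standard_word_def gram_def min_def)
qed

text \<open>Without pairs the sum is the determinant of the basis vectors, that is, of the identity matrix.\<close>

lemma word_value_standard_word_det: "word_value n n 0 (standard_word n) = 1"
proof -
  have "word_value n n 0 (standard_word n) =
      (\<Sum>\<rho>\<in>sorted_pairing n 0. if \<rho> = id then 1 else 0)"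
    unfolding word_value_def pairing_sum_def
  proof (rule sum.cong[OF refl])
    fix \<rho> assume "\<rho> \<in> sorted_pairing n 0"
    then have \<rho>: "\<rho> permutes {..<n}" by (simp add: sorted_pairing_def pairing_def)
    have sw: "standard_word n (\<rho> k) = \<rho> k" if "k < n" for k
      using pairing_lt[OF \<rho> that] by (simp add: standard_word_def)
    show "pairing_term n 0 (\<lambda>k i. if standard_word n i = k then 1 else 0)
        (\<lambda>i j. gram n (standard_word n i) (standard_word n j)) \<rho> = (if \<rho> = id then 1 else 0)"
    proof (cases "\<rho> = id")
      case False
      then obtain k where "\<rho> k \<noteq> k" by (auto simp: fun_eq_iff)
      moreover then have "k < n" using permutes_not_in[OF \<rho>] by force
      ultimately have "(\<Prod>k<n. if standard_word n (\<rho> k) = k then 1 else 0 :: int) = 0"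
        by (intro prod_zero) (auto simp: sw)
      then show ?thesis using False by (simp add: pairing_term_def)
    qed (auto simp: pairing_term_def standard_word_def intro!: prod.neutral)
  qed
  also have "id \<in> sorted_pairing n 0"
    by (auto simp: sorted_pairing_def pairing_def permutes_id strict_mono_on_def)
  then have "(\<Sum>\<rho>\<in>sorted_pairing n 0. if \<rho> = id then 1 else 0 :: int) = 1" by simp
  finally show ?thesis .
qed

text \<open>In x_1 y_1 ... x_\<nu> y_\<nu> each letter is orthogonal to all others but its partner, so the only
  matching that contributes pairs x_r with y_r, for all r.\<close>

lemma word_value_standard_word_pf:
  assumes "n = 2 * \<nu> + 1"
  shows "word_value n 0 \<nu> (standard_word n) = 1"
proof -
  have "word_value n 0 \<nu> (standard_word n) = (\<Sum>\<rho>\<in>sorted_pairing 0 \<nu>. if \<rho> = id then 1 else 0)"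
    unfolding word_value_def pairing_sum_def
  proof (rule sum.cong[OF refl])
    fix \<rho> assume s: "\<rho> \<in> sorted_pairing 0 \<nu>"
    then have \<rho>: "\<rho> permutes {..<2 * \<nu>}" by (simp add: sorted_pairing_def pairing_def)
    have lt: "\<rho> (2 * i) < \<rho> (2 * i + 1)" if "i < \<nu>" for i
      using s that by (simp add: sorted_pairing_def pairing_def)
    have sw: "standard_word n (\<rho> k) = \<rho> k" if "k < 2 * \<nu>" for k
      using pairing_lt[OF \<rho> that] assms by (simp add: standard_word_def)
    show "pairing_term 0 \<nu> (\<lambda>k i. if standard_word n i = k then 1 else 0)
        (\<lambda>i j. gram n (standard_word n i) (standard_word n j)) \<rho> = (if \<rho> = id then 1 else 0)"
    proof (cases "\<forall>i<\<nu>. gram n (\<rho> (2 * i)) (\<rho> (2 * i + 1)) \<noteq> 0")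
      case True
      have *: "\<rho> (2 * i) = 2 * (\<rho> (2 * i) div 2) \<and> \<rho> (2 * i + 1) = 2 * (\<rho> (2 * i) div 2) + 1"
        if i: "i < \<nu>" for i
      proof -
        have "\<rho> (2 * i) < 2 * \<nu>" "\<rho> (2 * i + 1) < 2 * \<nu>"
          using pairing_lt[OF \<rho>, of "2 * i"] pairing_lt[OF \<rho>, of "2 * i + 1"] i by auto
        moreover have "gram n (\<rho> (2 * i)) (\<rho> (2 * i + 1)) \<noteq> 0" using True i by blast
        ultimately have "\<rho> (2 * i) div 2 = \<rho> (2 * i + 1) div 2"
          unfolding gram_def assms by (simp split: if_splits)
        then show ?thesis using lt[OF i] by presburger
      qed
      have mono: "strict_mono_on {..<\<nu>} (\<lambda>i. \<rho> (2 * i) div 2)"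
      proof (rule strict_mono_onI)
        fix i j assume ij: "i \<in> {..<\<nu>}" "j \<in> {..<\<nu>}" "i < j"
        then have "\<rho> (2 * i) < \<rho> (2 * j)"
          using s strict_mono_onD[of "{..<\<nu>}" "\<lambda>i. \<rho> (2 * i)" i j] by (simp add: sorted_pairing_def)
        then show "\<rho> (2 * i) div 2 < \<rho> (2 * j) div 2" using *[of i] *[of j] ij by auto
      qed
      have "(\<lambda>i. \<rho> (2 * i) div 2) ` {..<\<nu>} = {..<\<nu>}"
      proof (rule endo_inj_surj)
        show "(\<lambda>i. \<rho> (2 * i) div 2) ` {..<\<nu>} \<subseteq> {..<\<nu>}"
        proof (rule image_subsetI)
          fix i assume "i \<in> {..<\<nu>}"
          then show "\<rho> (2 * i) div 2 \<in> {..<\<nu>}" using pairing_lt[OF \<rho>, of "2 * i"] by auto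
        qed
      qed (use mono strict_mono_on_imp_inj_on in auto)
      then have half: "\<rho> (2 * i) div 2 = i" if "i < \<nu>" for i
        using sorted_unique[of 0 \<nu> "\<lambda>i. \<rho> (2 * i) div 2" "\<lambda>i. i" i] mono that
        by (simp add: atLeast0LessThan strict_mono_on_def)
      have "\<rho> x = x" for x
      proof (cases "x < 2 * \<nu>")
        case True
        then have "x div 2 < \<nu>" by auto
        then show ?thesis using *[of "x div 2"] half[of "x div 2"] by (cases "even x") auto
      qed (use permutes_not_in[OF \<rho>] in auto)
      then have "\<rho> = id" by (simp add: fun_eq_iff)
      moreover have "gram n (standard_word n (2 * i)) (standard_word n (Suc (2 * i))) = 1" if "i < \<nu>" for i
        using that assms by (simp add: gram_def standard_word_def min_def)
      ultimately show ?thesis by (simp add: pairing_term_def)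
    next
      case False
      then obtain i where i: "i < \<nu>" "gram n (\<rho> (2 * i)) (\<rho> (2 * i + 1)) = 0" by blast
      then have "gram n (standard_word n (\<rho> (2 * i))) (standard_word n (\<rho> (2 * i + 1))) = 0"
        by (simp add: sw)
      then have "(\<Prod>i<\<nu>. gram n (standard_word n (\<rho> (2 * i))) (standard_word n (\<rho> (2 * i + 1)))) = 0"
        using i(1) by (intro prod_zero) auto
      moreover have "\<rho> \<noteq> id" using i assms by (auto simp: gram_def)
      ultimately show ?thesis by (simp add: pairing_term_def)
    qed
  qed
  also have "id \<in> sorted_pairing 0 \<nu>"
    by (auto simp: sorted_pairing_def pairing_def permutes_id strict_mono_on_def)
  then have "(\<Sum>\<rho>\<in>sorted_pairing 0 \<nu>. if \<rho> = id then 1 else 0 :: int) = 1" by simp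
  finally show ?thesis .
qed

lemma word_value_standard_word:
  assumes n: "odd n" and d: "d = 0 \<or> d = n" and l: "n div 2 \<le> (d + 2 * l) div 2"
  shows "word_value n d l (standard_word n) = 2 ^ ((d + 2 * l) div 2 - n div 2)"
proof -
  obtain \<nu> where \<nu>: "n = 2 * \<nu> + 1" using n by (elim oddE)
  show ?thesis
  proof (cases "d = 0")
    case True
    have "word_value n 0 (Suc (\<nu> + j)) (standard_word n) = 2 * word_value n 0 (\<nu> + j) (standard_word n)" for j
      by (rule word_value_standard_word_step) (simp add: \<nu>)
    then have "word_value n 0 (\<nu> + j) (standard_word n) = 2 ^ j" for j
      using word_value_standard_word_pf[OF \<nu>] by (induction j) simp_all
    from this[of "l - \<nu>"] show ?thesis using l True \<nu> by simp
  next
    case False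
    have "word_value n n l (standard_word n) = 2 ^ l"
      by (induction l) (simp_all add: word_value_standard_word_det word_value_standard_word_step)
    then show ?thesis using False d by simp
  qed
qed


section \<open>The polynomials g and h as sums over pairings\<close>

lemma pfaffian_eq_pairing_sum:
  "pfaffian l A = pairing_sum 0 l a (\<lambda>i j. A $$ (i, j))"
proof -
  have "{\<sigma>. \<sigma> permutes {..<2 * l} \<and> (\<forall>i<l. \<sigma> (2 * i) < \<sigma> (2 * i + 1)) \<and>
        (\<forall>i j. i < j \<and> j < l \<longrightarrow> \<sigma> (2 * i) < \<sigma> (2 * j))} = sorted_pairing 0 l"
    by (auto simp: sorted_pairing_def pairing_def strict_mono_on_def)
  then show ?thesis
    by (simp add: pfaffian_def pairing_sum_def pairing_term_def)
qed

lemma Pfpoly_eq_pairing_sum: "Pfpoly n l s = pairing_sum 0 l a (\<lambda>i j. Bpoly n (s i) (s j))"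
  unfolding Pfpoly_def pfaffian_eq_pairing_sum[where a = a] pairing_sum_def
proof (rule sum.cong[OF refl])
  fix \<rho> assume \<rho>: "\<rho> \<in> sorted_pairing 0 l"
  then have p: "\<rho> permutes {..<2 * l}" and lt: "\<And>i. i < l \<Longrightarrow> \<rho> (2 * i) < \<rho> (2 * i + 1)"
    by (auto simp: sorted_pairing_def pairing_def)
  have "\<rho> (2 * i) < 2 * l" "\<rho> (2 * i + 1) < 2 * l" if "i < l" for i
    using that pairing_lt[OF p] by auto
  then show "pairing_term 0 l a (\<lambda>i j. mat (2 * l) (2 * l) (\<lambda>(a, b). if a < b then Bpoly n (s a) (s b)
        else if b < a then - Bpoly n (s b) (s a) else 0) $$ (i, j)) \<rho> =
      pairing_term 0 l a (\<lambda>i j. Bpoly n (s i) (s j)) \<rho>"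
    using lt by (auto simp: pairing_term_def intro!: prod.cong)
qed

lemma g_poly_eq_pairing_sum:
  "g_poly n m = Const (2 powi (- (int (m div 2) - int (n div 2)))) * pairing_sum 0 (m div 2) Var (Bpoly n)"
  by (simp add: g_poly_def Pfpoly_eq_pairing_sum[where a = Var])

lemma Dpoly_expand:
  "Dpoly n s = (\<Sum>\<tau> | \<tau> permutes {..<n}. of_int (sign \<tau>) * (\<Prod>i<n. Var i (s (\<tau> i))))"
proof -
  have "(\<Prod>i<n. mat n n (\<lambda>(k, l). Var k (s l)) $$ (i, \<tau> i)) = (\<Prod>i<n. Var i (s (\<tau> i)))"
    if "\<tau> permutes {..<n}" for \<tau>
    using pairing_lt[OF that] by (intro prod.cong) auto
  then show ?thesis
    unfolding Dpoly_def Determinant.det_def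
    by (auto simp: atLeast0LessThan intro!: sum.cong)
qed

definition shift_perm :: "nat \<Rightarrow> (nat \<Rightarrow> nat) \<Rightarrow> nat \<Rightarrow> nat" where
  "shift_perm d \<sigma> x = (if x < d then x else d + \<sigma> (x - d))"

lemma shift_perm_comp: "shift_perm d (\<sigma> \<circ> \<sigma>') = shift_perm d \<sigma> \<circ> shift_perm d \<sigma>'"
  by (auto simp: shift_perm_def)

lemma shift_perm_id: "shift_perm d id = id"
  by (auto simp: shift_perm_def)

lemma shift_perm_permutes:
  assumes "\<sigma> permutes {..<l}"
  shows "shift_perm d \<sigma> permutes {..<d + l}"
proof -
  have "shift_perm d \<sigma> \<circ> shift_perm d (inv_into UNIV \<sigma>) = id"
    "shift_perm d (inv_into UNIV \<sigma>) \<circ> shift_perm d \<sigma> = id"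
    using assms by (simp_all add: permutes_inv_o shift_perm_id flip: shift_perm_comp)
  then have "bij (shift_perm d \<sigma>)" using o_bij by blast
  moreover have "shift_perm d \<sigma> x = x" if "x \<notin> {..<d + l}" for x
    using that permutes_not_in[OF assms, of "x - d"] by (auto simp: shift_perm_def)
  ultimately show ?thesis unfolding permutes_def by (metis bij_iff)
qed

lemma sign_shift_perm:
  assumes "\<sigma> permutes {..<l}"
  shows "sign (shift_perm d \<sigma>) = sign \<sigma>"
  using assms finite_lessThan[of l]
proof (induction rule: permutes_induct)
  case id
  show ?case unfolding shift_perm_id by (rule refl)
next
  case (swap a b p)
  have perm: "permutation p" "permutation (shift_perm d p)"
    using \<open>p permutes {..<l}\<close> shift_perm_permutes[of p l d] by (auto simp: permutation_permutes)
  have "shift_perm d (transpose a b) = transpose (d + a) (d + b)"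
    by (auto simp: shift_perm_def transpose_def fun_eq_iff)
  then show ?case
    unfolding shift_perm_comp using swap perm
    by (subst (1 2) sign_compose) (simp_all add: permutation_swap_id sign_swap_id)
qed

text \<open>A sorted pairing with n single points factors uniquely: a shuffle selects the set of single
  points, a permutation of them gives a term of the determinant, and a perfect matching of
  the other points gives a term of the Pfaffian.\<close>

lemma sum_shuffles:
  fixes n l :: nat
  defines "m \<equiv> n + 2 * l"
  shows "(\<Sum>\<pi> | \<pi> permutes {..<m} \<and> strict_mono_on {..<n} \<pi> \<and> strict_mono_on {n..<m} \<pi>.
        of_int (sign \<pi>) * Dpoly n \<pi> * Pfpoly n l (\<lambda>k. \<pi> (n + k))) = pairing_sum n l Var (Bpoly n)"
proof -
  let ?S = "{\<pi>. \<pi> permutes {..<m} \<and> strict_mono_on {..<n} \<pi> \<and> strict_mono_on {n..<m} \<pi>}"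
  let ?T = "{\<tau>. \<tau> permutes {..<n}}"
  let ?M = "sorted_pairing 0 l"
  let ?h = "\<lambda>(\<pi>, \<tau>, \<sigma>). \<pi> \<circ> (\<tau> \<circ> shift_perm n \<sigma>)"
  have M: "\<sigma> permutes {..<2 * l}" if "\<sigma> \<in> ?M" for \<sigma>
    using that by (simp add: sorted_pairing_def pairing_def)
  have low: "(\<tau> \<circ> shift_perm n \<sigma>) x = \<tau> x" if "x < n" for \<tau> \<sigma> x
    using that by (simp add: shift_perm_def)
  have high: "(\<tau> \<circ> shift_perm n \<sigma>) (n + x) = n + \<sigma> x" if "\<tau> \<in> ?T" for \<tau> \<sigma> x
    using that permutes_not_in[of \<tau> "{..<n}"] by (simp add: shift_perm_def)
  have im_low: "(\<lambda>x. (\<pi> \<circ> (\<tau> \<circ> shift_perm n \<sigma>)) x) ` {..<n} = \<pi> ` {..<n}" if "\<tau> \<in> ?T" for \<pi> \<tau> \<sigma>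
  proof -
    have "(\<lambda>x. (\<pi> \<circ> (\<tau> \<circ> shift_perm n \<sigma>)) x) ` {..<n} = \<pi> ` \<tau> ` {..<n}"
      unfolding image_image by (rule image_cong) (simp_all add: shift_perm_def)
    then show ?thesis using that permutes_image[of \<tau> "{..<n}"] by simp
  qed
  have split: "{n..<m} = (\<lambda>x. n + x) ` {..<2 * l}"
    by (auto simp: m_def image_iff) (metis add_less_cancel_left le_add_diff_inverse lessThan_iff)
  have im_high: "(\<lambda>x. (\<pi> \<circ> (\<tau> \<circ> shift_perm n \<sigma>)) x) ` {n..<m} = \<pi> ` {n..<m}"
    if "\<tau> \<in> ?T" "\<sigma> \<in> ?M" for \<pi> \<tau> \<sigma>
  proof -
    have "(\<lambda>x. (\<pi> \<circ> (\<tau> \<circ> shift_perm n \<sigma>)) x) ` {n..<m} = \<pi> ` (\<lambda>x. n + x) ` \<sigma> ` {..<2 * l}"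
      unfolding split image_image by (rule image_cong) (use high[OF that(1)] in simp_all)
    then show ?thesis using permutes_image[OF M[OF that(2)]] split by simp
  qed
  have inj: "inj_on ?h (?S \<times> ?T \<times> ?M)"
  proof (rule inj_onI)
    fix x y assume x: "x \<in> ?S \<times> ?T \<times> ?M" and y: "y \<in> ?S \<times> ?T \<times> ?M" and hxy: "?h x = ?h y"
    obtain \<pi> \<tau> \<sigma> where x': "x = (\<pi>, \<tau>, \<sigma>)" by (metis prod_cases3)
    obtain \<pi>' \<tau>' \<sigma>' where y': "y = (\<pi>', \<tau>', \<sigma>')" by (metis prod_cases3)
    have \<pi>: "\<pi> \<in> ?S" "\<pi>' \<in> ?S" and \<tau>: "\<tau> \<in> ?T" "\<tau>' \<in> ?T" and \<sigma>: "\<sigma> \<in> ?M" "\<sigma>' \<in> ?M"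
      and eq: "\<pi> \<circ> (\<tau> \<circ> shift_perm n \<sigma>) = \<pi>' \<circ> (\<tau>' \<circ> shift_perm n \<sigma>')"
      using x y hxy by (auto simp: x' y')
    have "\<pi> i = \<pi>' i" for i
    proof -
      consider "i < n" | "n \<le> i" "i < m" | "m \<le> i" by linarith
      then show ?thesis
      proof cases
        case 1
        have "\<pi> ` {..<n} = \<pi>' ` {..<n}"
          using im_low[OF \<tau>(1), of \<pi> \<sigma>] im_low[OF \<tau>(2), of \<pi>' \<sigma>'] eq by simp
        then show ?thesis
          using sorted_unique[of 0 n \<pi> \<pi>' i] \<pi> 1 by (auto simp: atLeast0LessThan)
      next
        case 2
        have "\<pi> ` {n..<m} = \<pi>' ` {n..<m}"
          using im_high[OF \<tau>(1) \<sigma>(1), of \<pi>] im_high[OF \<tau>(2) \<sigma>(2), of \<pi>'] eq by simp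
        then show ?thesis
          using sorted_unique[of n m \<pi> \<pi>' i] \<pi> 2 by auto
      next
        case 3
        then show ?thesis using \<pi> permutes_not_in[of \<pi> "{..<m}" i] permutes_not_in[of \<pi>' "{..<m}" i] by simp
      qed
    qed
    then have pp: "\<pi> = \<pi>'" by blast
    have "inj \<pi>" using \<pi> permutes_inj by auto
    then have eq': "\<tau> \<circ> shift_perm n \<sigma> = \<tau>' \<circ> shift_perm n \<sigma>'"
      using eq pp by (metis fun.inj_map_strong comp_apply ext injD)
    have "\<tau> i = \<tau>' i" for i
    proof (cases "i < n")
      case True
      then show ?thesis using low[OF True, of \<tau> \<sigma>] low[OF True, of \<tau>' \<sigma>'] eq' by simp
    qed (use \<tau> permutes_not_in[of \<tau> "{..<n}" i] permutes_not_in[of \<tau>' "{..<n}" i] in simp)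
    moreover have "\<sigma> i = \<sigma>' i" for i
      using high[OF \<tau>(1), of \<sigma> i] high[OF \<tau>(2), of \<sigma>' i] eq' by simp
    ultimately show "x = y" using pp x' y' by (simp add: fun_eq_iff)
  qed
  have surj: "?h ` (?S \<times> ?T \<times> ?M) = sorted_pairing n l"
  proof
    show "?h ` (?S \<times> ?T \<times> ?M) \<subseteq> sorted_pairing n l"
    proof (rule image_subsetI)
      fix x assume x: "x \<in> ?S \<times> ?T \<times> ?M"
      obtain \<pi> \<tau> \<sigma> where x': "x = (\<pi>, \<tau>, \<sigma>)" by (metis prod_cases3)
      have \<pi>: "\<pi> \<in> ?S" and \<tau>: "\<tau> \<in> ?T" and \<sigma>: "\<sigma> \<in> ?M" using x by (auto simp: x')
      have "shift_perm n \<sigma> permutes {..<m}" unfolding m_def by (rule shift_perm_permutes[OF M[OF \<sigma>]])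
      moreover have "\<tau> permutes {..<m}" by (rule permutes_subset[of \<tau> "{..<n}"]) (use \<tau> in \<open>auto simp: m_def\<close>)
      ultimately have perm: "\<pi> \<circ> (\<tau> \<circ> shift_perm n \<sigma>) permutes {..<m}"
        using \<pi> by (auto intro!: permutes_compose)
      have val: "(\<pi> \<circ> (\<tau> \<circ> shift_perm n \<sigma>)) (n + j) = \<pi> (n + \<sigma> j)" for j
        using high[OF \<tau>, of \<sigma> j] by simp
      have \<pi>mono: "\<pi> (n + \<sigma> i) < \<pi> (n + \<sigma> j)" if "\<sigma> i < \<sigma> j" "j < 2 * l" for i j
      proof -
        have "\<sigma> j < 2 * l" using pairing_lt[OF M[OF \<sigma>] that(2)] .
        then show ?thesis
          using \<pi> that strict_mono_onD[of "{n..<m}" \<pi> "n + \<sigma> i" "n + \<sigma> j"] by (simp add: m_def)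
      qed
      have "\<pi> (n + \<sigma> (2 * i)) < \<pi> (n + \<sigma> (2 * i + 1))" if "i < l" for i
        using \<sigma> that by (intro \<pi>mono) (auto simp: sorted_pairing_def pairing_def)
      moreover have "strict_mono_on {..<l} (\<lambda>i. \<pi> (n + \<sigma> (2 * i)))"
      proof (rule strict_mono_onI)
        fix i j assume "i \<in> {..<l}" "j \<in> {..<l}" "i < j"
        then show "\<pi> (n + \<sigma> (2 * i)) < \<pi> (n + \<sigma> (2 * j))"
          using \<sigma> strict_mono_onD[of "{..<l}" "\<lambda>i. \<sigma> (2 * i)" i j]
          by (intro \<pi>mono) (auto simp: sorted_pairing_def)
      qed
      ultimately show "?h x \<in> sorted_pairing n l"
        using perm val unfolding x' sorted_pairing_def pairing_def m_def
        by (simp add: add.assoc del: comp_apply add_Suc_right)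
    qed
    show "sorted_pairing n l \<subseteq> ?h ` (?S \<times> ?T \<times> ?M)"
    proof
      fix \<rho> assume \<rho>: "\<rho> \<in> sorted_pairing n l"
      then have p: "\<rho> permutes {..<m}" by (simp add: sorted_pairing_def pairing_def m_def)
      then have inj\<rho>: "inj \<rho>" by (rule permutes_inj)
      have "inj_on \<rho> {..<n}" using inj\<rho> by (rule inj_on_subset) simp
      then obtain \<kappa> where \<kappa>: "\<kappa> permutes {..<n}" "strict_mono_on {..<n} (\<rho> \<circ> \<kappa>)"
        using sorting_exists by blast
      have "inj_on (\<lambda>x. \<rho> (n + x)) {..<2 * l}" by (rule inj_onI) (use injD[OF inj\<rho>] in fastforce)
      then obtain \<mu> where \<mu>: "\<mu> permutes {..<2 * l}" "strict_mono_on {..<2 * l} ((\<lambda>x. \<rho> (n + x)) \<circ> \<mu>)"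
        using sorting_exists by blast
      define \<pi> where "\<pi> = \<rho> \<circ> (\<kappa> \<circ> shift_perm n \<mu>)"
      define \<tau> where "\<tau> = inv_into UNIV \<kappa>"
      define \<sigma> where "\<sigma> = inv_into UNIV \<mu>"
      have \<tau>: "\<tau> \<in> ?T" using permutes_inv[OF \<kappa>(1)] by (simp add: \<tau>_def)
      have \<sigma>p: "\<sigma> permutes {..<2 * l}" using permutes_inv[OF \<mu>(1)] by (simp add: \<sigma>_def)
      have \<pi>low: "\<pi> x = \<rho> (\<kappa> x)" if "x < n" for x using low[OF that, of \<kappa> \<mu>] by (simp add: \<pi>_def)
      have \<pi>high: "\<pi> (n + x) = \<rho> (n + \<mu> x)" for x using high[of \<kappa> \<mu> x] \<kappa>(1) by (simp add: \<pi>_def)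
      have \<pi>S: "\<pi> \<in> ?S"
      proof (intro CollectI conjI)
        have "shift_perm n \<mu> permutes {..<m}" unfolding m_def by (rule shift_perm_permutes[OF \<mu>(1)])
        moreover have "\<kappa> permutes {..<m}" by (rule permutes_subset[of \<kappa> "{..<n}"]) (use \<kappa> in \<open>auto simp: m_def\<close>)
        ultimately show "\<pi> permutes {..<m}" unfolding \<pi>_def using p by (auto intro!: permutes_compose)
        show "strict_mono_on {..<n} \<pi>"
          using \<kappa>(2) by (auto simp: strict_mono_on_def \<pi>low)
        show "strict_mono_on {n..<m} \<pi>"
        proof (rule strict_mono_onI)
          fix i j assume "i \<in> {n..<m}" "j \<in> {n..<m}" "i < j"
          moreover then obtain i' j' where "i = n + i'" "j = n + j'"
            by (metis atLeastLessThan_iff le_add_diff_inverse)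
          ultimately show "\<pi> i < \<pi> j"
            using strict_mono_onD[OF \<mu>(2), of i' j'] by (simp add: \<pi>high m_def)
        qed
      qed
      have \<rho>high: "\<rho> (n + x) = \<pi> (n + \<sigma> x)" for x
        using \<pi>high[of "\<sigma> x"] permutes_inverses(1)[OF \<mu>(1)] by (simp add: \<sigma>_def)
      have \<sigma>mono: "\<sigma> i < \<sigma> j" if "\<rho> (n + i) < \<rho> (n + j)" "i < 2 * l" "j < 2 * l" for i j
      proof -
        have "\<sigma> i < 2 * l" "\<sigma> j < 2 * l" using pairing_lt[OF \<sigma>p] that by auto
        then show ?thesis
          using that(1) \<pi>S strict_mono_on_less[of "{n..<m}" \<pi> "n + \<sigma> i" "n + \<sigma> j"]
          unfolding \<rho>high by (simp add: m_def)
      qed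
      have "\<sigma> \<in> ?M"
        unfolding sorted_pairing_def pairing_def
      proof (intro CollectI conjI allI impI strict_mono_onI)
        show "\<sigma> permutes {..<0 + 2 * l}" using \<sigma>p by simp
        show "\<sigma> (0 + 2 * i) < \<sigma> (0 + 2 * i + 1)" if "i < l" for i
          using \<rho> that \<sigma>mono[of "2 * i" "2 * i + 1"] by (simp add: sorted_pairing_def pairing_def)
        show "\<sigma> (0 + 2 * i) < \<sigma> (0 + 2 * j)" if "i \<in> {..<l}" "j \<in> {..<l}" "i < j" for i j
          using \<rho> that \<sigma>mono[of "2 * i" "2 * j"] strict_mono_onD[of "{..<l}" "\<lambda>i. \<rho> (n + 2 * i)" i j]
          by (simp add: sorted_pairing_def)
      qed
      moreover have "\<rho> = \<pi> \<circ> (\<tau> \<circ> shift_perm n \<sigma>)"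
      proof
        fix x
        show "\<rho> x = (\<pi> \<circ> (\<tau> \<circ> shift_perm n \<sigma>)) x"
        proof (cases "x < n")
          case True
          moreover have "\<tau> x < n" using \<tau> True pairing_lt[of \<tau> n x] by simp
          ultimately show ?thesis
            using low[OF True, of \<tau> \<sigma>] \<pi>low[of "\<tau> x"] permutes_inverses(1)[OF \<kappa>(1)] by (simp add: \<tau>_def)
        next
          case False
          then obtain y where y: "x = n + y" by (metis le_add_diff_inverse linorder_not_le)
          show ?thesis unfolding y \<rho>high using high[OF \<tau>, of \<sigma> y] by simp
        qed
      qed
      ultimately show "\<rho> \<in> ?h ` (?S \<times> ?T \<times> ?M)"
        using \<pi>S \<tau> by (auto intro!: image_eqI[of _ _ "(\<pi>, \<tau>, \<sigma>)"])
    qed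
  qed
  have factor: "pairing_term n l Var (Bpoly n) (\<pi> \<circ> (\<tau> \<circ> shift_perm n \<sigma>)) =
      of_int (sign \<pi>) * (of_int (sign \<tau>) * (\<Prod>i<n. Var i (\<pi> (\<tau> i)))) *
        pairing_term 0 l Var (\<lambda>i j. Bpoly n (\<pi> (n + i)) (\<pi> (n + j))) \<sigma>"
    if \<pi>: "\<pi> \<in> ?S" and \<tau>: "\<tau> \<in> ?T" and \<sigma>: "\<sigma> \<in> ?M" for \<pi> \<tau> \<sigma>
  proof -
    have perm: "permutation \<pi>" "permutation \<tau>" "permutation (shift_perm n \<sigma>)"
      using \<pi> \<tau> shift_perm_permutes[OF M[OF \<sigma>], of n] by (auto simp: permutation_permutes)
    then have sgn: "sign (\<pi> \<circ> (\<tau> \<circ> shift_perm n \<sigma>)) = sign \<pi> * sign \<tau> * sign \<sigma>"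
      using sign_shift_perm[OF M[OF \<sigma>], of n] by (simp add: sign_compose permutation_compose)
    have "(\<Prod>i<n. Var i ((\<pi> \<circ> (\<tau> \<circ> shift_perm n \<sigma>)) i)) = (\<Prod>i<n. Var i (\<pi> (\<tau> i)))"
      by (rule prod.cong) (simp_all add: shift_perm_def)
    moreover have "(\<pi> \<circ> (\<tau> \<circ> shift_perm n \<sigma>)) (n + x) = \<pi> (n + \<sigma> x)" for x
      using high[OF \<tau>, of \<sigma> x] by simp
    ultimately show ?thesis
      unfolding pairing_term_def sgn by (simp add: add.assoc mult_ac del: comp_apply add_Suc_right)
  qed
  have dist: "s * sum A T * sum B M = (\<Sum>\<tau>\<in>T. \<Sum>\<sigma>\<in>M. s * A \<tau> * B \<sigma>)"
    for s :: cpoly and A B :: "(nat \<Rightarrow> nat) \<Rightarrow> cpoly" and T M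
    by (subst mult.assoc, subst sum_product) (simp only: sum_distrib_left mult.assoc)
  have "pairing_sum n l Var (Bpoly n) =
      (\<Sum>(\<pi>, \<tau>, \<sigma>)\<in>?S \<times> ?T \<times> ?M. pairing_term n l Var (Bpoly n) (\<pi> \<circ> (\<tau> \<circ> shift_perm n \<sigma>)))"
    unfolding pairing_sum_def surj[symmetric] by (subst sum.reindex[OF inj]) (simp add: case_prod_beta o_def)
  also have "\<dots> = (\<Sum>(\<pi>, \<tau>, \<sigma>)\<in>?S \<times> ?T \<times> ?M.
      of_int (sign \<pi>) * (of_int (sign \<tau>) * (\<Prod>i<n. Var i (\<pi> (\<tau> i)))) *
        pairing_term 0 l Var (\<lambda>i j. Bpoly n (\<pi> (n + i)) (\<pi> (n + j))) \<sigma>)"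
  proof (rule sum.cong[OF refl])
    fix x assume x: "x \<in> ?S \<times> ?T \<times> ?M"
    obtain \<pi> \<tau> \<sigma> where x': "x = (\<pi>, \<tau>, \<sigma>)" by (metis prod_cases3)
    show "(case x of (\<pi>, \<tau>, \<sigma>) \<Rightarrow> pairing_term n l Var (Bpoly n) (\<pi> \<circ> (\<tau> \<circ> shift_perm n \<sigma>))) =
       (case x of (\<pi>, \<tau>, \<sigma>) \<Rightarrow> of_int (sign \<pi>) * (of_int (sign \<tau>) * (\<Prod>i<n. Var i (\<pi> (\<tau> i)))) *
        pairing_term 0 l Var (\<lambda>i j. Bpoly n (\<pi> (n + i)) (\<pi> (n + j))) \<sigma>)"
      using factor[of \<pi> \<tau> \<sigma>] x unfolding x' by (simp only: prod.case mem_Times_iff fst_conv snd_conv)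
  qed
  also have "\<dots> = (\<Sum>\<pi>\<in>?S. of_int (sign \<pi>) * Dpoly n \<pi> * Pfpoly n l (\<lambda>k. \<pi> (n + k)))"
    unfolding Dpoly_expand Pfpoly_eq_pairing_sum[where a = Var] pairing_sum_def sum.cartesian_product[symmetric] dist
    by (rule refl)
  finally show ?thesis by simp
qed

lemma h_poly_eq_pairing_sum:
  assumes "m = n + 2 * l"
  shows "h_poly n m = Const (2 powi (- (int (m div 2) - int (n div 2)))) * pairing_sum n l Var (Bpoly n)"
  unfolding h_poly_def assms using sum_shuffles[of n l] by simp

section \<open>Coefficients of the pairing sums\<close>

lemma sum_slots:
  fixes f :: "nat \<Rightarrow> nat"
  shows "(\<Sum>k<d. f k) + (\<Sum>i<l. f (d + 2 * i) + f (d + 2 * i + 1)) = (\<Sum>k<d + 2 * l. f k)"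
  by (induction l) auto

lemma homog_Bpoly:
  assumes "odd n"
  shows "homog (vdeg n j) (of_bool (j = x) + of_bool (j = y)) (Bpoly n x y)"
proof -
  have two: "(2 :: cpoly) = Const 2" by (simp add: Const_def)
  have VV: "homog (vdeg n j) (of_bool (j = x) + of_bool (j = y)) (Var k x * Var k' y)" if "k < n" "k' < n" for k k'
    using that by (intro homog_mult homog_Var)
  have "2 * r + 1 < n" if "r < n div 2" for r using that assms by presburger
  then show ?thesis
    unfolding Bpoly_def two mult.assoc
    using assms by (intro homog_add homog_sum homog_Const_mult VV) (auto simp: odd_pos)
qed

lemma Rpolys_Bpoly:
  assumes "odd n" "x < m" "y < m"
  shows "Bpoly n x y \<in> Rpolys n m"
proof -
  have two: "(2 :: cpoly) = Const 2" by (simp add: Const_def)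
  have "2 * r + 1 < n" if "r < n div 2" for r using that assms by presburger
  then show ?thesis
    unfolding Bpoly_def two
    using assms by (intro Rpolys_add Rpolys_sum Rpolys_mult Rpolys_Const Rpolys_Var) (auto simp: odd_pos)
qed

text \<open>Each vector occurs at exactly one position of a permutation, and every position contributes
  degree 1 in its vector.\<close>

lemma multilinear_pairing_sum:
  assumes n: "odd n" and d: "d \<le> n"
  shows "multilinear n (d + 2 * l) (Const c * pairing_sum d l Var (Bpoly n))"
proof -
  let ?m = "d + 2 * l"
  have "Const c * pairing_sum d l Var (Bpoly n) \<in> Rpolys n ?m \<and>
      homog (vdeg n j) 1 (Const c * pairing_sum d l Var (Bpoly n))" if j: "j < ?m" for j
    unfolding pairing_sum_def
  proof (intro conjI Rpolys_mult Rpolys_Const Rpolys_sum homog_Const_mult homog_sum)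
    fix \<rho> assume "\<rho> \<in> sorted_pairing d l"
    then have \<rho>: "\<rho> permutes {..<?m}" by (simp add: sorted_pairing_def pairing_def)
    have of_int: "of_int (sign \<rho>) = Const (of_int (sign \<rho>))" by simp
    have lt: "\<rho> (d + 2 * i) < ?m" "\<rho> (d + 2 * i + 1) < ?m" if "i < l" for i
      using pairing_lt[OF \<rho>] that by auto
    show "pairing_term d l Var (Bpoly n) \<rho> \<in> Rpolys n ?m"
      unfolding pairing_term_def of_int
      using d lt pairing_lt[OF \<rho>]
      by (intro Rpolys_mult Rpolys_Const Rpolys_prod Rpolys_Var Rpolys_Bpoly n) auto
    have "homog (vdeg n j) ((\<Sum>k<d. of_bool (j = \<rho> k)) +
        (\<Sum>i<l. of_bool (j = \<rho> (d + 2 * i)) + of_bool (j = \<rho> (d + 2 * i + 1))))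
        (pairing_term d l Var (Bpoly n) \<rho>)"
      unfolding pairing_term_def of_int mult.assoc
      using d by (intro homog_Const_mult homog_mult homog_prod homog_Var homog_Bpoly n) auto
    moreover have "(\<Sum>k<d. of_bool (j = \<rho> k)) +
        (\<Sum>i<l. of_bool (j = \<rho> (d + 2 * i)) + of_bool (j = \<rho> (d + 2 * i + 1))) = (1 :: nat)"
    proof -
      have "(\<Sum>k<?m. of_bool (j = \<rho> k)) = (\<Sum>k<?m. of_bool (j = k) :: nat)"
        using sum.permute[OF \<rho>, of "\<lambda>k. of_bool (j = k)"] unfolding o_def by (rule sym)
      also have "\<dots> = 1" using j by simp
      finally show ?thesis unfolding sum_slots[of "\<lambda>k. of_bool (j = \<rho> k)" d l] .
    qed
    ultimately show "homog (vdeg n j) 1 (pairing_term d l Var (Bpoly n) \<rho>)" by simp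
  qed
  moreover have "Const c * pairing_sum d l Var (Bpoly n) \<in> Rpolys n ?m" if "?m = 0"
    using that by (auto simp: pairing_sum_def pairing_term_def intro!: Rpolys_mult Rpolys_Const Rpolys_sum
        simp flip: Const_of_int)
  ultimately show ?thesis
    unfolding multilinear_def homog_def vdeg_def by blast
qed

lemma multilinear_key:
  assumes "multilinear n m p" "t \<in> keys p"
  shows "\<exists>w\<in>{..<m} \<rightarrow>\<^sub>E {..<n}. t = word_monom {..<m} w"
  using assms by (intro word_monom_exists) (auto simp: multilinear_def Rpolys_def vdeg_def)

text \<open>The substitution evaluates at the basis vectors selected by w, where the monomial of w has the
  value 1 and the monomials of all other words vanish.\<close>

lemma subst_word:
  assumes p: "multilinear n m p"
  shows "subst (\<lambda>(k, i). Const (if w i = k then 1 else 0)) p = Const (lookup p (word_monom {..<m} w))"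
proof -
  let ?s = "\<lambda>(k, i). Const (if w i = k then 1 else 0)"
  have key: "subst_monom ?s t = (if t = word_monom {..<m} w then 1 else 0)" if t: "t \<in> keys p" for t
  proof -
    obtain v where v: "t = word_monom {..<m} v" using multilinear_key[OF p t] by blast
    have eq: "subst_monom ?s t = (\<Prod>i<m. Const (if w i = v i then 1 else 0))"
      unfolding v by (subst subst_monom_word_monom) auto
    show ?thesis
    proof (cases "t = word_monom {..<m} w")
      case True
      then have "v i = w i" if "i < m" for i
        using word_monom_inject[of "{..<m}" v w i] that v by simp
      then show ?thesis using True eq by simp
    next
      case False
      then obtain i where "i < m" "w i \<noteq> v i" using v word_monom_cong[of "{..<m}" v w] by fastforce
      then have "(\<Prod>i<m. Const (if w i = v i then 1 else 0)) = 0" by (intro prod_zero) auto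
      then show ?thesis using False eq by simp
    qed
  qed
  have "subst ?s p = (\<Sum>t\<in>keys p. if t = word_monom {..<m} w then Const (lookup p t) else 0)"
    unfolding subst_def subst_monom_def[symmetric] by (rule sum.cong) (auto simp: key)
  then show ?thesis by (simp add: in_keys_iff)
qed

lemma subst_Bpoly_word:
  assumes n: "odd n" and w: "w i < n" "w j < n"
  shows "subst (\<lambda>(k, i). Const (if w i = k then 1 else 0)) (Bpoly n i j) = of_int (gram n (w i) (w j))"
proof -
  let ?f = "\<lambda>r. Const ((if w i = 2 * r then 1 else 0) * (if w j = 2 * r + 1 then 1 else 0) +
       (if w i = 2 * r + 1 then 1 else 0) * (if w j = 2 * r then 1 else 0))"
  have two: "(2 :: cpoly) = Const 2" by (simp add: Const_def)
  have sum: "(\<Sum>r<n div 2. ?f r) = (\<Sum>r<n div 2. if r = w i div 2 then ?f (w i div 2) else 0)"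
    by (rule sum.cong) auto
  have "subst (\<lambda>(k, i). Const (if w i = k then 1 else 0)) (Bpoly n i j) =
      (\<Sum>r<n div 2. ?f r) + Const (2 * (if w i = n - 1 then 1 else 0) * (if w j = n - 1 then 1 else 0))"
    unfolding Bpoly_def two by (simp add: hom_distribs Const_mult Const_add)
  also have "\<dots> = of_int (gram n (w i) (w j))"
  proof (cases "w i = n - 1 \<or> w j = n - 1")
    case True
    then have "(\<Sum>r<n div 2. ?f r) = 0" 
      using n by (intro sum.neutral) (auto elim!: oddE)
    then show ?thesis using True by (auto simp: gram_def two)
  next
    case False
    then have "w i div 2 < n div 2" using w n by (auto elim!: oddE)
    then have "(\<Sum>r<n div 2. ?f r) = ?f (w i div 2)" unfolding sum by simp
    moreover have "?f (w i div 2) = of_int (if w i \<noteq> w j \<and> w i div 2 = w j div 2 then 1 else 0)"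
    proof -
      have "w i = 2 * (w i div 2) \<longleftrightarrow> even (w i)" "w i = 2 * (w i div 2) + 1 \<longleftrightarrow> odd (w i)"
        "w j = 2 * (w i div 2) \<longleftrightarrow> even (w j) \<and> w i div 2 = w j div 2"
        "w j = 2 * (w i div 2) + 1 \<longleftrightarrow> odd (w j) \<and> w i div 2 = w j div 2"
        "w i \<noteq> w j \<and> w i div 2 = w j div 2 \<longleftrightarrow> w i div 2 = w j div 2 \<and> even (w i) \<noteq> even (w j)"
        by presburger+
      then show ?thesis
        by (cases "even (w i)"; cases "even (w j)"; cases "w i div 2 = w j div 2") (simp_all only:, simp_all)
    qed
    ultimately show ?thesis using False by (simp add: gram_def)
  qed
  finally show ?thesis .
qed

lemma lookup_pairing_sum:
  assumes n: "odd n" and d: "d \<le> n" and w: "\<And>i. i < d + 2 * l \<Longrightarrow> w i < n"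
  shows "lookup (pairing_sum d l Var (Bpoly n)) (word_monom {..<d + 2 * l} w) = of_int (word_value n d l w)"
proof -
  let ?s = "\<lambda>(k, i). Const (if w i = k then 1 else 0)"
  have of_int_if: "Const (if P then 1 else 0) = of_int (if P then 1 else 0)" for P by simp
  have "Const (lookup (pairing_sum d l Var (Bpoly n)) (word_monom {..<d + 2 * l} w)) =
      subst ?s (pairing_sum d l Var (Bpoly n))"
    using subst_word[OF multilinear_pairing_sum[OF n d, of l 1], of w] by simp
  also have "\<dots> = pairing_sum d l (\<lambda>k i. of_int (if w i = k then 1 else 0)) (\<lambda>i j. of_int (gram n (w i) (w j)))"
    unfolding subst_hom.hom_pairing_sum
    by (rule pairing_sum_cong) (use subst_Bpoly_word[OF n] w in \<open>simp_all\<close>)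
  also have "\<dots> = of_int (word_value n d l w)"
    unfolding word_value_def by (rule of_int_hom.hom_pairing_sum[symmetric])
  also have "\<dots> = Const (of_int (word_value n d l w))" by simp
  finally show ?thesis unfolding Const_inject .
qed

text \<open>Every coefficient is the value at a word, so the divisibility of these values gives
  integrality.\<close>

lemma scaled_pairing_sum:
  assumes n: "odd n" and d: "d = 0 \<or> d = n" and m: "m = d + 2 * l" "n \<le> m"
  defines "p \<equiv> Const (2 powi (- (int (m div 2) - int (n div 2)))) * pairing_sum d l Var (Bpoly n)"
  shows "multilinear n m p" and "lookup p t \<in> \<int>"
    and "lookup p (word_monom {..<m} (standard_word n)) = 1"
proof -
  have dn: "d \<le> n" using d by auto
  show ml: "multilinear n m p" unfolding p_def m using multilinear_pairing_sum[OF n dn] .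
  define e where "e = m div 2 - n div 2"
  have e: "int (m div 2) - int (n div 2) = int e" using m(2) by (simp add: e_def of_nat_diff div_le_mono)
  have p: "p = Const (1 / 2 ^ e) * pairing_sum d l Var (Bpoly n)"
    unfolding p_def e by (simp add: power_int_minus field_simps)
  have lookup_p: "lookup p (word_monom {..<m} w) = of_int (word_value n d l w) / 2 ^ e"
    if "\<And>i. i < m \<Longrightarrow> w i < n" for w
    using lookup_pairing_sum[OF n dn, of l w] that unfolding p lookup_Const_mult m by simp
  have n0: "0 < n" using n by (rule odd_pos)
  show "lookup p (word_monom {..<m} (standard_word n)) = 1"
  proof -
    have "standard_word n i < n" for i using n0 by (simp add: standard_word_def min_less_iff_disj)
    moreover have "word_value n d l (standard_word n) = 2 ^ e"
      unfolding e_def m(1) by (rule word_value_standard_word[OF n d]) (use m in \<open>metis div_le_mono\<close>)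
    ultimately show ?thesis using lookup_p[of "standard_word n"] by simp
  qed
  show "lookup p t \<in> \<int>"
  proof (cases "t \<in> keys p")
    case True
    then obtain w where w: "w \<in> {..<m} \<rightarrow>\<^sub>E {..<n}" "t = word_monom {..<m} w"
      using multilinear_key[OF ml] by blast
    define v where "v i = (if i < m then w i else 0)" for i
    have v: "\<And>i. v i < n" using w n0 by (auto simp: v_def)
    have t: "t = word_monom {..<m} v" unfolding w(2) by (rule word_monom_cong) (simp add: v_def)
    have "2 ^ e dvd word_value n d l v" unfolding e_def m by (rule word_value_dvd[OF n d v])
    then obtain k where "word_value n d l v = 2 ^ e * k" by (elim dvdE)
    then show ?thesis using lookup_p[of v] v unfolding t by simp
  qed (simp add: in_keys_iff)
qed


section \<open>The orthogonal group\<close>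

text \<open>The only coordinate whose basis vector is not orthogonal to that of k.\<close>

definition partner :: "nat \<Rightarrow> nat \<Rightarrow> nat" where
  "partner n k = (if k = n - 1 then k else if even k then k + 1 else k - 1)"

lemma partner_lt: "odd n \<Longrightarrow> k < n \<Longrightarrow> partner n k < n"
  by (auto simp: partner_def elim!: oddE)

lemma partner_partner: "odd n \<Longrightarrow> k < n \<Longrightarrow> partner n (partner n k) = k"
  by (auto simp: partner_def elim!: oddE)

lemma partner_last: "odd n \<Longrightarrow> k < n \<Longrightarrow> partner n k = n - 1 \<longleftrightarrow> k = n - 1"
  by (auto simp: partner_def elim!: oddE)

lemma gram_partner:
  assumes "odd n" "k < n"
  shows "gram n k l = (if l = partner n k then (if k = n - 1 then 2 else 1) else 0)"
proof (cases "k = n - 1 \<or> l = n - 1")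
  case True
  then show ?thesis using partner_last[OF assms] by (auto simp: gram_def partner_def)
next
  case False
  have "k \<noteq> l \<and> k div 2 = l div 2 \<longleftrightarrow> l = (if even k then k + 1 else k - 1)"
  proof (cases "even k")
    case True
    then obtain a where a: "k = 2 * a" by (elim evenE)
    show ?thesis unfolding a by simp presburger
  next
    case False
    then obtain a where a: "k = 2 * a + 1" by (elim oddE)
    show ?thesis unfolding a by simp presburger
  qed
  then show ?thesis using False by (simp add: gram_def partner_def)
qed

lemma gram_form:
  fixes u v :: "nat \<Rightarrow> 'a::comm_ring_1"
  assumes n: "odd n"
  shows "(\<Sum>r<n div 2. u (2 * r) * v (2 * r + 1) + u (2 * r + 1) * v (2 * r)) + 2 * u (n - 1) * v (n - 1) =
    (\<Sum>k<n. \<Sum>l<n. of_int (gram n k l) * (u k * v l))"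
proof -
  obtain \<nu> where \<nu>: "n = 2 * \<nu> + 1" using n by (elim oddE)
  have slots: "(\<Sum>k<2 * N. f k) = (\<Sum>r<N. f (2 * r) + f (2 * r + 1))" for N and f :: "nat \<Rightarrow> 'a"
    by (induction N) (auto simp: add.assoc)
  have "(\<Sum>k<n. \<Sum>l<n. of_int (gram n k l) * (u k * v l)) =
      (\<Sum>k<n. of_int (if k = n - 1 then 2 else 1) * (u k * v (partner n k)))" (is "_ = (\<Sum>k<n. ?f k)")
  proof (rule sum.cong[OF refl])
    fix k assume k: "k \<in> {..<n}"
    have "(\<Sum>l<n. of_int (gram n k l) * (u k * v l)) =
        (\<Sum>l<n. if l = partner n k then ?f k else 0)"
      using k by (intro sum.cong) (auto simp: gram_partner[OF n])
    then show "(\<Sum>l<n. of_int (gram n k l) * (u k * v l)) = ?f k"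
      using partner_lt[OF n] k by simp
  qed
  also have "\<dots> = (\<Sum>r<\<nu>. ?f (2 * r) + ?f (2 * r + 1)) + ?f (2 * \<nu>)"
    unfolding \<nu> by (simp add: slots)
  also have "(\<Sum>r<\<nu>. ?f (2 * r) + ?f (2 * r + 1)) =
      (\<Sum>r<\<nu>. u (2 * r) * v (2 * r + 1) + u (2 * r + 1) * v (2 * r))"
    unfolding \<nu> by (rule sum.cong) (auto simp: partner_def)
  finally show ?thesis unfolding \<nu> by (simp add: partner_def mult.assoc)
qed

lemma Bpoly_gram:
  "odd n \<Longrightarrow> Bpoly n i j = (\<Sum>k<n. \<Sum>l<n. of_int (gram n k l) * (Var k i * Var l j))"
  unfolding Bpoly_def by (rule gram_form)

lemma qform_polarise:
  assumes "odd n" "u \<in> carrier_vec n" "v \<in> carrier_vec n"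
  shows "qform n (u + v) - qform n u - qform n v =
    (\<Sum>k<n. \<Sum>l<n. of_int (gram n k l) * (u $ k * v $ l))"
proof -
  have lt: "2 * r + 1 < n" if "r < n div 2" for r using that assms(1) by presburger
  have "(\<Sum>r<n div 2. (u + v) $ (2 * r) * (u + v) $ (2 * r + 1)) =
      (\<Sum>r<n div 2. u $ (2 * r) * u $ (2 * r + 1)) + (\<Sum>r<n div 2. v $ (2 * r) * v $ (2 * r + 1)) +
      (\<Sum>r<n div 2. u $ (2 * r) * v $ (2 * r + 1) + u $ (2 * r + 1) * v $ (2 * r))"
    unfolding sum.distrib[symmetric] using lt assms(2,3) by (intro sum.cong) (auto simp: algebra_simps)
  moreover have "(u + v) $ (n - 1) = u $ (n - 1) + v $ (n - 1)"
    using assms odd_pos[of n] by auto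
  ultimately show ?thesis
    unfolding gram_form[OF assms(1), symmetric] qform_def by (simp add: power2_eq_square algebra_simps)
qed

definition preserves_qform :: "nat \<Rightarrow> complex mat \<Rightarrow> bool" where
  "preserves_qform n A \<longleftrightarrow> A \<in> carrier_mat n n \<and> (\<forall>v\<in>carrier_vec n. qform n (A *\<^sub>v v) = qform n v)"

lemma preserves_gram:
  assumes n: "odd n" and A: "preserves_qform n A" and l: "l < n" "l' < n"
  shows "(\<Sum>k<n. \<Sum>k'<n. of_int (gram n k k') * (A $$ (k, l) * A $$ (k', l'))) = of_int (gram n l l')"
proof -
  have AC: "A \<in> carrier_mat n n" using A by (simp add: preserves_qform_def)
  let ?u = "unit_vec n l :: complex vec" and ?v = "unit_vec n l' :: complex vec"
  have Au: "A *\<^sub>v ?u \<in> carrier_vec n" "A *\<^sub>v ?v \<in> carrier_vec n" using AC by auto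
  have col: "(A *\<^sub>v unit_vec n j) $ k = A $$ (k, j)" if "k < n" "j < n" for k j
    using AC that by (simp add: scalar_prod_right_unit)
  have "(\<Sum>k<n. \<Sum>k'<n. of_int (gram n k k') * (A $$ (k, l) * A $$ (k', l'))) =
      (\<Sum>k<n. \<Sum>k'<n. of_int (gram n k k') * ((A *\<^sub>v ?u) $ k * (A *\<^sub>v ?v) $ k'))"
    by (intro sum.cong refl) (simp add: col l)
  also have "\<dots> = qform n (A *\<^sub>v (?u + ?v)) - qform n (A *\<^sub>v ?u) - qform n (A *\<^sub>v ?v)"
    using qform_polarise[OF n Au] AC by (simp add: mult_add_distrib_mat_vec[of A n n])
  also have "\<dots> = qform n (?u + ?v) - qform n ?u - qform n ?v"
    using A by (simp add: preserves_qform_def)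
  also have "\<dots> = (\<Sum>k<n. \<Sum>k'<n. of_int (gram n k k') * (?u $ k * ?v $ k'))"
    by (rule qform_polarise[OF n]) auto
  also have "\<dots> = (\<Sum>k<n. if k = l then (\<Sum>k'<n. if k' = l' then of_int (gram n l l') else 0) else 0)"
  proof (rule sum.cong[OF refl])
    fix k assume k: "k \<in> {..<n}"
    have "(\<Sum>k'<n. of_int (gram n k k') * (?u $ k * ?v $ k')) =
        (\<Sum>k'<n. if k = l then if k' = l' then of_int (gram n l l') else 0 else 0)"
      by (rule sum.cong) (use k l in auto)
    then show "(\<Sum>k'<n. of_int (gram n k k') * (?u $ k * ?v $ k')) =
        (if k = l then (\<Sum>k'<n. if k' = l' then of_int (gram n l l') else 0) else 0)"
      by simp
  qed
  finally show ?thesis using l by simp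
qed

text \<open>If G is the Gram matrix and A preserves q, then the transpose of A times G times A is G.
  As G is invertible over the complex numbers, taking determinants gives det A = 1 or -1, and an
  inverse of A can be written down.\<close>

lemma preserves_qform_det:
  assumes n: "odd n" and A: "preserves_qform n A"
  shows "invertible_mat A" and "Determinant.det A = 1 \<or> Determinant.det A = - 1"
proof -
  define G where "G = Matrix.mat n n (\<lambda>(k, l). complex_of_int (gram n k l))"
  define G' where "G' = Matrix.mat n n (\<lambda>(k, l).
     if l = partner n k then (if k = n - 1 then 1 / 2 else 1) else (0 :: complex))"
  have AC: "A \<in> carrier_mat n n" using A by (simp add: preserves_qform_def)
  have GC: "G \<in> carrier_mat n n" "G' \<in> carrier_mat n n" by (simp_all add: G_def G'_def)
  have TC: "transpose_mat A \<in> carrier_mat n n" using AC by simp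
  have "G' * G = 1\<^sub>m n"
  proof (rule eq_matI)
    fix k l assume kl: "k < dim_row (1\<^sub>m n :: complex mat)" "l < dim_col (1\<^sub>m n :: complex mat)"
    have "(G' * G) $$ (k, l) = (\<Sum>j<n. G' $$ (k, j) * G $$ (j, l))"
      using kl GC by (simp add: scalar_prod_def atLeast0LessThan)
    also have "\<dots> = (\<Sum>j<n. if j = partner n k then (if k = n - 1 then 1 / 2 else 1) * of_int (gram n j l) else 0)"
      using kl by (intro sum.cong) (auto simp: G_def G'_def)
    also have "\<dots> = (if k = n - 1 then 1 / 2 else 1) * of_int (gram n (partner n k) l)"
      using kl partner_lt[OF n] by simp
    also have "\<dots> = (1\<^sub>m n) $$ (k, l)"
    proof -
      have "gram n (partner n k) l = (if l = k then if k = n - 1 then 2 else 1 else 0)"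
        using gram_partner[OF n partner_lt[OF n], of k l] partner_partner[OF n, of k] partner_last[OF n, of k] kl
        by simp
      then show ?thesis using kl by simp
    qed
    finally show "(G' * G) $$ (k, l) = (1\<^sub>m n) $$ (k, l)" .
  qed (simp_all add: G_def G'_def)
  moreover have AGA: "transpose_mat A * G * A = G"
  proof (rule eq_matI)
    fix l l' assume ll: "l < dim_row G" "l' < dim_col G"
    then have l: "l < n" "l' < n" by (simp_all add: G_def)
    have "(transpose_mat A * G * A) $$ (l, l') = (\<Sum>k<n. A $$ (k, l) * (\<Sum>k'<n. G $$ (k, k') * A $$ (k', l')))"
      using l AC GC by (simp add: scalar_prod_def atLeast0LessThan)
    also have "\<dots> = (\<Sum>k<n. \<Sum>k'<n. of_int (gram n k k') * (A $$ (k, l) * A $$ (k', l')))"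
      by (simp add: sum_distrib_left G_def mult_ac)
    also have "\<dots> = of_int (gram n l l')"
      by (rule preserves_gram[OF n A l])
    finally show "(transpose_mat A * G * A) $$ (l, l') = G $$ (l, l')" using l by (simp add: G_def)
  qed (use AC GC in auto)
  ultimately have inv: "(G' * (transpose_mat A * G)) * A = 1\<^sub>m n"
    using GC TC AC by (simp add: assoc_mult_mat[of _ n n _ n _ n])
  have LC: "G' * (transpose_mat A * G) \<in> carrier_mat n n" using GC TC by simp
  have inv': "A * (G' * (transpose_mat A * G)) = 1\<^sub>m n"
    by (rule mat_mult_left_right_inverse[OF LC AC inv])
  have "inverts_mat A (G' * (transpose_mat A * G))" "inverts_mat (G' * (transpose_mat A * G)) A"
    unfolding inverts_mat_def inv inv' using AC GC by simp_all
  then show "invertible_mat A" unfolding invertible_mat_def using AC by auto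
  have "Determinant.det (G' * G) = 1" using \<open>G' * G = 1\<^sub>m n\<close> by simp
  then have "Determinant.det G \<noteq> 0" using det_mult[OF GC(2) GC(1)] by auto
  moreover have "Determinant.det A * Determinant.det G * Determinant.det A = Determinant.det G"
    using arg_cong[OF AGA, of Determinant.det] GC TC AC
    by (simp add: det_mult[of _ n] det_transpose[OF AC])
  ultimately have "Determinant.det A * Determinant.det A = 1" by (simp add: mult_ac)
  then show "Determinant.det A = 1 \<or> Determinant.det A = - 1"
    by (simp add: square_eq_1_iff)
qed

lemma O_group_iff: "odd n \<Longrightarrow> A \<in> O_group n \<longleftrightarrow> preserves_qform n A"
  using preserves_qform_det(1) by (auto simp: O_group_def preserves_qform_def)

text \<open>The determinant is continuous and takes only the values 1 and -1 on O(n), so it is constant on a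
  connected set.\<close>

lemma SO_group_det:
  assumes n: "odd n" and A: "A \<in> SO_group n"
  shows "Determinant.det A = 1"
proof -
  define dt where "dt f = Determinant.det (Matrix.mat n n f)" for f :: "nat \<times> nat \<Rightarrow> complex"
  have dt_entries: "dt (entries n B) = Determinant.det B" if "B \<in> carrier_mat n n" for B
    unfolding dt_def by (rule arg_cong[of _ _ Determinant.det], rule eq_matI) (use that in \<open>auto simp: entries_def\<close>)
  have carrier: "B \<in> carrier_mat n n" if "B \<in> O_group n" for B using that by (simp add: O_group_def)
  obtain C where C: "connected C" "C \<subseteq> entries n ` O_group n"
      "entries n (1\<^sub>m n) \<in> C" "entries n A \<in> C"
    using A by (auto simp: SO_group_def connected_component_def)
  have cont: "continuous_on C dt"
  proof -
    have "dt f = (\<Sum>p | p permutes {0..<n}. of_int (sign p) * (\<Prod>i = 0..<n. f (i, p i)))" for f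
      unfolding dt_def Determinant.det_def
      by (auto intro!: sum.cong prod.cong dest: permutes_in_image)
    then have dt_eq: "dt = (\<lambda>f. \<Sum>p | p permutes {0..<n}. of_int (sign p) * (\<Prod>i = 0..<n. f (i, p i)))"
      by blast
    have coord: "continuous_on C (\<lambda>f. f x)" for x :: "nat \<times> nat"
      by (rule continuous_on_product_then_coordinatewise) simp
    show ?thesis unfolding dt_eq by (intro continuous_intros coord)
  qed
  have vals: "dt ` C \<subseteq> {1, -1}"
  proof (rule image_subsetI)
    fix c assume "c \<in> C"
    then obtain B where "B \<in> O_group n" "c = entries n B" using C(2) by auto
    then show "dt c \<in> {1, -1}"
      using dt_entries[OF carrier] preserves_qform_det(2)[OF n] O_group_iff[OF n] by auto
  qed
  have "connected (dt ` C)" using cont C(1) by (rule connected_continuous_image)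
  then have "- {1} \<inter> dt ` C = {} \<or> - {- 1} \<inter> dt ` C = {}"
    using vals by (intro connectedD) auto
  moreover have "1 \<in> dt ` C"
    using imageI[OF C(3), of dt] dt_entries[of "1\<^sub>m n"] by simp
  moreover have "(1 :: complex) \<noteq> - 1" by simp
  ultimately have "dt ` C \<subseteq> {1}" by blast
  moreover have "Determinant.det A \<in> dt ` C"
    using imageI[OF C(4), of dt] dt_entries[of A] A carrier by (simp add: SO_group_def)
  ultimately show ?thesis by auto
qed

section \<open>Invariance of g and h\<close>

lemma act_Bpoly:
  assumes n: "odd n" and A: "A \<in> O_group n"
  shows "act n A (Bpoly n i j) = Bpoly n i j"
proof -
  have of_int: "of_int c = Const (of_int c)" for c by simp
  have "act n A (Bpoly n i j) = (\<Sum>k<n. \<Sum>k'<n. Const (of_int (gram n k k')) *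
      ((\<Sum>l<n. Const (A $$ (k, l)) * Var l i) * (\<Sum>l<n. Const (A $$ (k', l)) * Var l j)))"
    unfolding Bpoly_gram[OF n] of_int by (simp add: act_hom.hom_sum act_hom.hom_mult act_Var del: Const_of_int)
  also have "\<dots> = (\<Sum>k<n. \<Sum>k'<n. \<Sum>l<n. \<Sum>l'<n.
      Const (of_int (gram n k k') * (A $$ (k, l) * A $$ (k', l'))) * (Var l i * Var l' j))"
    unfolding sum_product by (simp add: sum_distrib_left mult_ac flip: Const_mult del: Const_of_int)
  also have "\<dots> = (\<Sum>l<n. \<Sum>l'<n. \<Sum>k<n. \<Sum>k'<n.
      Const (of_int (gram n k k') * (A $$ (k, l) * A $$ (k', l'))) * (Var l i * Var l' j))"
  proof -
    have pull: "(\<Sum>k<n. \<Sum>k'<n. \<Sum>l<n. f k k' l) = (\<Sum>l<n. \<Sum>k<n. \<Sum>k'<n. f k k' l)"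
      for f :: "nat \<Rightarrow> nat \<Rightarrow> nat \<Rightarrow> cpoly"
      by (rule trans[OF sum.cong[OF refl sum.swap] sum.swap])
    show ?thesis by (subst pull, rule sum.cong[OF refl pull])
  qed
  also have "\<dots> = (\<Sum>l<n. \<Sum>l'<n.
      Const (\<Sum>k<n. \<Sum>k'<n. of_int (gram n k k') * (A $$ (k, l) * A $$ (k', l'))) * (Var l i * Var l' j))"
    by (simp add: Const_sum sum_distrib_right)
  also have "\<dots> = (\<Sum>l<n. \<Sum>l'<n. of_int (gram n l l') * (Var l i * Var l' j))"
    using A by (intro sum.cong refl) (simp add: preserves_gram[OF n] O_group_iff[OF n])
  finally show ?thesis unfolding Bpoly_gram[OF n] .
qed

lemma act_Pfpoly:
  assumes n: "odd n" and A: "A \<in> O_group n"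
  shows "act n A (Pfpoly n l s) = Pfpoly n l s"
  unfolding Pfpoly_eq_pairing_sum[where a = Var] act_hom.hom_pairing_sum act_Bpoly[OF n A]
  by (rule pairing_sum_cong) auto

interpretation Const_hom: comm_ring_hom Const
  by unfold_locales (auto simp: Const_add Const_mult)

lemma act_Dpoly:
  assumes A: "A \<in> carrier_mat n n"
  shows "act n A (Dpoly n s) = Const (Determinant.det A) * Dpoly n s"
proof -
  let ?V = "Matrix.mat n n (\<lambda>(k, l). Var k (s l))"
  have "act n A (Dpoly n s) = Determinant.det (map_mat (act n A) ?V)"
    unfolding Dpoly_def by simp
  also have "map_mat (act n A) ?V = map_mat Const A * ?V"
    by (rule eq_matI) (use A in \<open>auto simp: act_Var scalar_prod_def atLeast0LessThan\<close>)
  also have "Determinant.det \<dots> = Determinant.det (map_mat Const A) * Determinant.det ?V"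
    using A by (intro det_mult[of _ n]) auto
  finally show ?thesis by (simp add: Dpoly_def)
qed

lemma g_poly_invariant:
  assumes "odd n" "A \<in> O_group n"
  shows "act n A (g_poly n m) = g_poly n m"
  by (simp add: g_poly_def act_hom.hom_mult act_Pfpoly[OF assms])

lemma h_poly_invariant:
  assumes n: "odd n" and A: "A \<in> SO_group n"
  shows "act n A (h_poly n m) = h_poly n m"
proof -
  have AO: "A \<in> O_group n" "A \<in> carrier_mat n n" using A by (auto simp: SO_group_def O_group_def)
  have of_int: "of_int c = Const (of_int c)" for c by simp
  show ?thesis
    unfolding h_poly_def act_hom.hom_mult act_hom.hom_sum of_int act_Const
      act_Pfpoly[OF n AO(1)] act_Dpoly[OF AO(2)] SO_group_det[OF n A]
    by simp
qed

section \<open>One-parameter subgroups acting on three coordinates\<close>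

text \<open>A 3 by 3 matrix M acts on the coordinates numbered 2r, 2r + 1 and n - 1, in this order, and
  the other coordinates are fixed. All elements of SO(n) that the argument needs have this form.\<close>

definition three_row :: "nat \<Rightarrow> nat \<Rightarrow> (nat \<Rightarrow> complex) \<Rightarrow> nat \<Rightarrow> complex" where
  "three_row n r f l = (if l = 2 * r then f 0 else if l = 2 * r + 1 then f 1 else if l = n - 1 then f 2 else 0)"

definition three_block :: "nat \<Rightarrow> nat \<Rightarrow> (nat \<Rightarrow> nat \<Rightarrow> complex) \<Rightarrow> complex mat" where
  "three_block n r M = Matrix.mat n n (\<lambda>(k, l). if k = 2 * r then three_row n r (M 0) l
     else if k = 2 * r + 1 then three_row n r (M 1) l
     else if k = n - 1 then three_row n r (M 2) l else if k = l then 1 else 0)"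

lemma sum_three_row:
  assumes n: "odd n" and r: "r < n div 2"
  shows "(\<Sum>l<n. three_row n r f l * v l) = f 0 * v (2 * r) + f 1 * v (2 * r + 1) + f 2 * v (n - 1)"
proof -
  have d: "2 * r < n" "2 * r + 1 < n - 1" "n - 1 < n" using n r by (auto elim!: oddE)
  have "(\<Sum>l<n. three_row n r f l * v l) =
     (\<Sum>l<n. (if l = 2 * r then f 0 * v (2 * r) else 0) + (if l = 2 * r + 1 then f 1 * v (2 * r + 1) else 0) +
       (if l = n - 1 then f 2 * v (n - 1) else 0))"
    using d by (intro sum.cong) (auto simp: three_row_def)
  then show ?thesis using d by (simp add: sum.distrib)
qed

lemma three_block_preserves:
  assumes n: "odd n" and r: "r < n div 2"
    and M: "\<And>x y z. (M 0 0 * x + M 0 1 * y + M 0 2 * z) * (M 1 0 * x + M 1 1 * y + M 1 2 * z) +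
      (M 2 0 * x + M 2 1 * y + M 2 2 * z)\<^sup>2 = x * y + z\<^sup>2"
  shows "three_block n r M \<in> O_group n"
  unfolding O_group_iff[OF n] preserves_qform_def
proof (intro conjI ballI)
  show C: "three_block n r M \<in> carrier_mat n n" by (simp add: three_block_def)
  fix v :: "complex vec" assume v: "v \<in> carrier_vec n"
  have d: "2 * r < n" "2 * r + 1 < n - 1" "n - 1 < n" using n r by (auto elim!: oddE)
  have mv: "(three_block n r M *\<^sub>v v) $ k = (\<Sum>l<n. three_block n r M $$ (k, l) * v $ l)" if "k < n" for k
    using that v C by (simp add: scalar_prod_def atLeast0LessThan)
  have row: "(\<Sum>l<n. three_block n r M $$ (k, l) * v $ l) = (\<Sum>l<n. three_row n r (M j) l * v $ l)"
    if "k < n" "(k = 2 * r \<and> j = 0) \<or> (k = 2 * r + 1 \<and> j = 1) \<or> (k = n - 1 \<and> j = 2)" for k j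
    using that d by (intro sum.cong) (auto simp: three_block_def)
  have vals: "(three_block n r M *\<^sub>v v) $ (2 * r) = M 0 0 * v $ (2 * r) + M 0 1 * v $ (2 * r + 1) + M 0 2 * v $ (n - 1)"
    "(three_block n r M *\<^sub>v v) $ (2 * r + 1) = M 1 0 * v $ (2 * r) + M 1 1 * v $ (2 * r + 1) + M 1 2 * v $ (n - 1)"
    "(three_block n r M *\<^sub>v v) $ (n - 1) = M 2 0 * v $ (2 * r) + M 2 1 * v $ (2 * r + 1) + M 2 2 * v $ (n - 1)"
    using d row[of "2 * r" 0] row[of "2 * r + 1" 1] row[of "n - 1" 2]
    by (simp_all add: mv sum_three_row[OF n r] del: One_nat_def add_Suc_right)
  have other: "(three_block n r M *\<^sub>v v) $ k = v $ k" if k: "k < n" "k \<notin> {2 * r, 2 * r + 1, n - 1}" for k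
  proof -
    have "(\<Sum>l<n. three_block n r M $$ (k, l) * v $ l) = (\<Sum>l<n. if l = k then v $ k else 0)"
      using k by (intro sum.cong) (auto simp: three_block_def)
    then show ?thesis using k mv by simp
  qed
  let ?q = "\<lambda>w r. w $ (2 * r) * w $ (2 * r + 1) :: complex"
  have rest: "(\<Sum>s\<in>{..<n div 2} - {r}. ?q (three_block n r M *\<^sub>v v) s) = (\<Sum>s\<in>{..<n div 2} - {r}. ?q v s)"
  proof (rule sum.cong[OF refl])
    fix s assume "s \<in> {..<n div 2} - {r}"
    then have "2 * s + 1 < n - 1" "s \<noteq> r" using n by (auto elim!: oddE)
    then have "(three_block n r M *\<^sub>v v) $ (2 * s) = v $ (2 * s)" "(three_block n r M *\<^sub>v v) $ (2 * s + 1) = v $ (2 * s + 1)"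
      by (intro other; simp; presburger)+
    then show "?q (three_block n r M *\<^sub>v v) s = ?q v s" by simp
  qed
  have split: "(\<Sum>s<n div 2. ?q w s) = ?q w r + (\<Sum>s\<in>{..<n div 2} - {r}. ?q w s)" for w
    using r by (intro sum.remove) auto
  have "qform n (three_block n r M *\<^sub>v v) =
      (?q (three_block n r M *\<^sub>v v) r + ((three_block n r M *\<^sub>v v) $ (n - 1))\<^sup>2) + (\<Sum>s\<in>{..<n div 2} - {r}. ?q v s)"
    unfolding qform_def split rest by simp
  also have "?q (three_block n r M *\<^sub>v v) r + ((three_block n r M *\<^sub>v v) $ (n - 1))\<^sup>2 = ?q v r + (v $ (n - 1))\<^sup>2"
    unfolding vals by (rule M)
  also have "\<dots> + (\<Sum>s\<in>{..<n div 2} - {r}. ?q v s) = qform n v"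
    unfolding qform_def split by simp
  finally show "qform n (three_block n r M *\<^sub>v v) = qform n v" .
qed

text \<open>A continuous curve in the orthogonal group that starts at the identity stays in its component.\<close>

lemma three_block_SO:
  fixes P :: "real \<Rightarrow> nat \<Rightarrow> nat \<Rightarrow> complex"
  assumes n: "odd n" and r: "r < n div 2"
    and P: "\<And>t x y z. (P t 0 0 * x + P t 0 1 * y + P t 0 2 * z) * (P t 1 0 * x + P t 1 1 * y + P t 1 2 * z) +
      (P t 2 0 * x + P t 2 1 * y + P t 2 2 * z)\<^sup>2 = x * y + z\<^sup>2"
    and cont: "\<And>i j. continuous_on UNIV (\<lambda>t. P t i j)"
    and P0: "\<And>i j. i < 3 \<Longrightarrow> j < 3 \<Longrightarrow> P 0 i j = (if i = j then 1 else 0)"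
  shows "three_block n r (P s) \<in> SO_group n"
proof -
  have O: "three_block n r (P t) \<in> O_group n" for t by (rule three_block_preserves[OF n r P])
  let ?f = "\<lambda>t. entries n (three_block n r (P t))"
  have row: "continuous_on UNIV (\<lambda>t. three_row n r (P t i) l)" for i l
    unfolding three_row_def using cont by (cases "l = 2 * r"; cases "l = 2 * r + 1"; cases "l = n - 1") simp_all
  have "continuous_on UNIV ?f"
  proof (rule continuous_on_coordinatewise_then_product)
    fix x :: "nat \<times> nat"
    obtain k l where x: "x = (k, l)" by (cases x)
    show "continuous_on UNIV (\<lambda>t. ?f t x)"
    proof (cases "k < n \<and> l < n")
      case True
      consider "k = 2 * r" | "k = 2 * r + 1" | "k \<noteq> 2 * r" "k \<noteq> 2 * r + 1" "k = n - 1"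
        | "k \<noteq> 2 * r" "k \<noteq> 2 * r + 1" "k \<noteq> n - 1" by blast
      then show ?thesis
        using True row by cases (auto simp: entries_def x three_block_def)
    qed (auto simp: entries_def x)
  qed
  then have "connected (range ?f)" by (rule connected_continuous_image) (rule connected_UNIV)
  moreover have "range ?f \<subseteq> entries n ` O_group n" using O by auto
  moreover have "three_block n r (P 0) = 1\<^sub>m n"
  proof (rule eq_matI)
    fix k l assume "k < dim_row (1\<^sub>m n :: complex mat)" "l < dim_col (1\<^sub>m n :: complex mat)"
    moreover have "2 * r + 1 < n - 1" using n r by (auto elim!: oddE)
    ultimately show "three_block n r (P 0) $$ (k, l) = (1\<^sub>m n) $$ (k, l)"
      by (auto simp: three_block_def three_row_def P0)
  qed (simp_all add: three_block_def)
  ultimately have "connected_component (entries n ` O_group n) (entries n (1\<^sub>m n)) (?f s)"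
    unfolding connected_component_def by (metis rangeI)
  then show ?thesis using O by (simp add: SO_group_def)
qed

definition torus_mat :: "real \<Rightarrow> nat \<Rightarrow> nat \<Rightarrow> complex" where
  "torus_mat t i j = (if i \<noteq> j then 0 else if i = 0 then of_real (exp t) else if i = 1 then of_real (exp (- t)) else 1)"

lemma torus_SO:
  assumes "odd n" "r < n div 2"
  shows "three_block n r (torus_mat t) \<in> SO_group n"
proof (rule three_block_SO[OF assms])
  show "continuous_on UNIV (\<lambda>t. torus_mat t i j)" for i j
    unfolding torus_mat_def
    by (cases "i = j"; cases "i = 0"; cases "i = 1") (auto intro!: continuous_intros)
  have "complex_of_real (exp t) * of_real (exp (- t)) = 1" for t
    by (simp add: exp_minus flip: of_real_mult)
  then show "(torus_mat t 0 0 * x + torus_mat t 0 1 * y + torus_mat t 0 2 * z) *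
      (torus_mat t 1 0 * x + torus_mat t 1 1 * y + torus_mat t 1 2 * z) +
      (torus_mat t 2 0 * x + torus_mat t 2 1 * y + torus_mat t 2 2 * z)\<^sup>2 = x * y + z\<^sup>2" for t x y z
    by (simp add: torus_mat_def mult_ac)
qed (auto simp: torus_mat_def)

text \<open>With x = a + ib and y = a - ib the form is a^2 + b^2 + z^2, and this is the rotation by the angle
  t in the plane of the coordinates a and z. At t = pi/2 it takes the basis vector of z to the sum of
  those of x and y; at t = pi it exchanges the basis vectors of x and y up to sign.\<close>

definition rotation_mat :: "real \<Rightarrow> nat \<Rightarrow> nat \<Rightarrow> complex" where
  "rotation_mat t i j =
    (if i < 2 \<and> j < 2 then (if i = j then (of_real (cos t) + 1) / 2 else (of_real (cos t) - 1) / 2)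
     else if i < 2 then of_real (sin t) else if j < 2 then - of_real (sin t) / 2 else of_real (cos t))"

lemma rotation_SO:
  assumes "odd n" "r < n div 2"
  shows "three_block n r (rotation_mat t) \<in> SO_group n"
proof (rule three_block_SO[OF assms])
  show "continuous_on UNIV (\<lambda>t. rotation_mat t i j)" for i j
    unfolding rotation_mat_def
    by (cases "i < 2"; cases "j < 2"; cases "i = j") (auto intro!: continuous_intros)
  show "(rotation_mat t 0 0 * x + rotation_mat t 0 1 * y + rotation_mat t 0 2 * z) *
      (rotation_mat t 1 0 * x + rotation_mat t 1 1 * y + rotation_mat t 1 2 * z) +
      (rotation_mat t 2 0 * x + rotation_mat t 2 1 * y + rotation_mat t 2 2 * z)\<^sup>2 = x * y + z\<^sup>2" for t x y z
  proof -
    define c s where "c = complex_of_real (cos t)" and "s = complex_of_real (sin t)"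
    have cs: "c\<^sup>2 + s\<^sup>2 = 1"
      unfolding c_def s_def by (metis of_real_1 of_real_add of_real_power sin_cos_squared_add2)
    have "((c + 1) / 2 * x + (c - 1) / 2 * y + s * z) * ((c - 1) / 2 * x + (c + 1) / 2 * y + s * z) +
      (- s / 2 * x + - s / 2 * y + c * z)\<^sup>2 =
      (c\<^sup>2 + s\<^sup>2) * ((x + y)\<^sup>2 / 4 + z\<^sup>2) - (x - y)\<^sup>2 / 4"
      by (simp add: field_simps power2_eq_square)
    also have "\<dots> = x * y + z\<^sup>2"
      unfolding cs by (simp add: field_simps power2_eq_square)
    finally show ?thesis
      unfolding rotation_mat_def c_def[symmetric] s_def[symmetric] by simp
  qed
qed (auto simp: rotation_mat_def)


section \<open>Coefficients of integral invariants\<close>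

text \<open>The case of a matrix in which each relevant column has only one nonzero entry, as for torus
  elements and for signed permutations of the basis.\<close>

lemma lookup_act_monomial:
  assumes p: "p \<in> Rpolys n m" and S: "S \<subseteq> {..<m}" and w: "\<And>i. i \<in> S \<Longrightarrow> w i < n"
    and u: "u \<in> S \<rightarrow>\<^sub>E {..<n}"
    and zero: "\<And>i k. i \<in> S \<Longrightarrow> k < n \<Longrightarrow> k \<noteq> u i \<Longrightarrow> A $$ (k, w i) = 0"
  shows "lookup (act n A p) (word_monom S w) = lookup p (word_monom S u) * (\<Prod>i\<in>S. A $$ (u i, w i))"
proof -
  have fin: "finite S" using S finite_subset by blast
  have "(\<Prod>i\<in>S. A $$ (v i, w i)) = 0" if v: "v \<in> S \<rightarrow>\<^sub>E {..<n}" "v \<noteq> u" for v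
  proof -
    obtain i where i: "i \<in> S" "v i \<noteq> u i" using PiE_ext[OF v(1) u] v(2) by blast
    moreover have "v i < n" using PiE_mem[OF v(1) i(1)] by simp
    ultimately have "A $$ (v i, w i) = 0" using zero by blast
    then show ?thesis using i(1) by (intro prod_zero[OF fin] bexI)
  qed
  then have "(\<Sum>v\<in>S \<rightarrow>\<^sub>E {..<n}. lookup p (word_monom S v) * (\<Prod>i\<in>S. A $$ (v i, w i))) =
      (\<Sum>v\<in>S \<rightarrow>\<^sub>E {..<n}. if v = u then lookup p (word_monom S u) * (\<Prod>i\<in>S. A $$ (u i, w i)) else 0)"
    by (intro sum.cong) auto
  also have "\<dots> = lookup p (word_monom S u) * (\<Prod>i\<in>S. A $$ (u i, w i))"
    using u fin by (simp add: finite_PiE)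
  finally show ?thesis using lookup_act_word_monom[OF p S w] by simp
qed

lemma standard_word_lt: "odd n \<Longrightarrow> standard_word n i < n"
  by (auto simp: standard_word_def min_def elim!: oddE)

text \<open>The torus scales x_{r+1} by 2 and y_{r+1} by 1/2, so a coefficient of an invariant vanishes
  unless both occur equally often.\<close>

lemma coeff_unbalanced:
  assumes n: "odd n" and p: "p \<in> invariants n m (SO_group n)" and S: "S \<subseteq> {..<m}"
    and r: "r < n div 2" and one: "(2 * r \<in> S) \<noteq> (2 * r + 1 \<in> S)"
  shows "lookup p (word_monom S (standard_word n)) = 0"
proof -
  let ?w = "standard_word n"
  let ?A = "three_block n r (torus_mat (ln 2))"
  have fin: "finite S" using S finite_subset by blast
  have d: "2 * r + 1 < n - 1" using n r by (auto elim!: oddE)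
  have entry: "?A $$ (k, l) = (if k \<noteq> l then 0 else if k = 2 * r then 2 else if k = 2 * r + 1 then 1 / 2 else 1)"
    if "k < n" "l < n" for k l
    using that d by (auto simp: three_block_def three_row_def torus_mat_def exp_minus)
  have wr: "?w i = 2 * r \<longleftrightarrow> i = 2 * r" "?w i = Suc (2 * r) \<longleftrightarrow> i = Suc (2 * r)" for i
    using d by (auto simp: standard_word_def min_def)
  have inv: "act n ?A p = p" "p \<in> Rpolys n m" using p torus_SO[OF n r] by (auto simp: invariants_def)
  define u where "u = restrict ?w S"
  have u: "u \<in> S \<rightarrow>\<^sub>E {..<n}" using standard_word_lt[OF n] by (auto simp: u_def)
  have "lookup p (word_monom S ?w) = lookup p (word_monom S u) * (\<Prod>i\<in>S. ?A $$ (u i, ?w i))"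
    using lookup_act_monomial[OF inv(2) S standard_word_lt[OF n] u, of ?A] inv(1)
    by (simp add: entry standard_word_lt[OF n] u_def)
  also have "word_monom S u = word_monom S ?w" by (rule word_monom_cong) (simp add: u_def)
  also have "(\<Prod>i\<in>S. ?A $$ (u i, ?w i)) =
      (\<Prod>i\<in>S. (if i = 2 * r then 2 else 1) * (if i = 2 * r + 1 then 1 / 2 else 1))"
    by (rule prod.cong) (auto simp: u_def entry standard_word_lt[OF n] wr)
  also have "\<dots> = (if 2 * r \<in> S then 2 else 1) * (if 2 * r + 1 \<in> S then 1 / 2 else 1)"
    using fin by (simp add: prod.distrib)
  finally show ?thesis using one by (auto split: if_splits)
qed

text \<open>If z occurs but neither x_{r+1} nor y_{r+1} does, then the rotation by a right angle replaces
  every z by x_{r+1} + y_{r+1}, and the rotation by two right angles exchanges x_{r+1} and y_{r+1} up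
  to sign. Hence the coefficient is a sum of integers that are equal in pairs up to sign.\<close>

lemma coeff_even:
  assumes n: "odd n" and p: "p \<in> invariantsZ n m (SO_group n)" and S: "S \<subseteq> {..<m}"
    and z: "z \<in> S" "n - 1 \<le> z" and r: "r < n div 2" "2 * r \<notin> S" "2 * r + 1 \<notin> S"
  shows "lookup p (word_monom S (standard_word n)) / 2 \<in> \<int>"
proof -
  let ?w = "standard_word n"
  let ?E = "S \<rightarrow>\<^sub>E {..<n}"
  let ?x = "2 * r" and ?y = "2 * r + 1"
  define F where "F v = lookup p (word_monom S v)" for v
  define t where "t = transpose ?x ?y"
  have fin: "finite S" using S finite_subset by blast
  have finE: "finite ?E" using fin by (intro finite_PiE) auto
  have d: "2 * r + 1 < n - 1" using n r by (auto elim!: oddE)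
  have pR: "p \<in> Rpolys n m" and pZ: "F v \<in> \<int>" and pI: "\<And>A. A \<in> SO_group n \<Longrightarrow> act n A p = p" for v
    using p by (auto simp: F_def invariantsZ_def RZpolys_def invariants_def)
  let ?Q = "three_block n r (rotation_mat (pi / 2))" and ?H = "three_block n r (rotation_mat pi)"
  have Q_other: "?Q $$ (k, l) = (if k = l then 1 else 0)" if "k < n" "l < n" "l \<notin> {?x, ?y, n - 1}" for k l
    using that d by (auto simp: three_block_def three_row_def)
  have Q_z: "?Q $$ (k, n - 1) = (if k \<in> {?x, ?y} then 1 else 0)" if "k < n" for k
    using that d by (auto simp: three_block_def three_row_def rotation_mat_def)
  have H: "?H $$ (k, l) = (if k = t l then if l \<in> {?x, ?y} then -1 else 1 else 0)"
    if "k < n" "l < n" "l \<noteq> n - 1" for k l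
    using that d by (auto simp: three_block_def three_row_def rotation_mat_def t_def transpose_def)
  have w_low: "?w i = i" "?w i \<notin> {?x, ?y, n - 1}" if "i \<in> S" "i < n - 1" for i
    using that r d by (auto simp: standard_word_def)
  have w_z: "?w i = n - 1" if "n - 1 \<le> i" for i using that by (simp add: standard_word_def)
  \<comment> \<open>The words obtained from the standard word by replacing every z by x or y.\<close>
  define V where "V = {v \<in> ?E. \<forall>i\<in>S. if i < n - 1 then v i = i else v i \<in> {?x, ?y}}"
  have finV: "finite V" using finE by (simp add: V_def)
  have "F ?w = lookup (act n ?Q p) (word_monom S ?w)"
    using pI[OF rotation_SO[OF n r(1)]] by (simp add: F_def)
  also have "\<dots> = (\<Sum>v\<in>?E. F v * (\<Prod>i\<in>S. ?Q $$ (v i, ?w i)))"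
    unfolding F_def by (rule lookup_act_word_monom[OF pR S standard_word_lt[OF n]])
  also have "\<dots> = (\<Sum>v\<in>?E. if v \<in> V then F v else 0)"
  proof (rule sum.cong[OF refl])
    fix v assume v: "v \<in> ?E"
    have entry: "?Q $$ (v i, ?w i) = (if (if i < n - 1 then v i = i else v i \<in> {?x, ?y}) then 1 else 0)"
      if "i \<in> S" for i
    proof (cases "i < n - 1")
      case True
      then show ?thesis using v that w_low[OF that True] by (subst Q_other) auto
    next
      case False
      moreover have "v i < n" using PiE_mem[OF v that] by simp
      ultimately show ?thesis using w_z[of i] Q_z[of "v i"] by simp
    qed
    have "(\<Prod>i\<in>S. ?Q $$ (v i, ?w i)) = (if v \<in> V then 1 else 0)"
    proof (cases "v \<in> V")
      case True
      then show ?thesis by (auto simp: V_def entry intro!: prod.neutral)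
    next
      case False
      then obtain i where "i \<in> S" "\<not> (if i < n - 1 then v i = i else v i \<in> {?x, ?y})"
        using v by (auto simp: V_def)
      then have "(\<Prod>i\<in>S. ?Q $$ (v i, ?w i)) = 0"
        using fin entry[of i] by (intro prod_zero) auto
      then show ?thesis using False by simp
    qed
    then show "F v * (\<Prod>i\<in>S. ?Q $$ (v i, ?w i)) = (if v \<in> V then F v else 0)" by simp
  qed
  also have "\<dots> = (\<Sum>v\<in>V. F v)"
    using finE by (simp add: sum.If_cases V_def Int_def)
  finally have sumV: "F ?w = (\<Sum>v\<in>V. F v)" .
  \<comment> \<open>The exchange of x and y, without fixed points on V because it changes the letter at z.\<close>
  define bar where "bar v = restrict (\<lambda>i. t (v i)) S" for v
  have bar_V: "bar v \<in> V" and bar_bar: "bar (bar v) = v" and bar_F: "F (bar v) = F v \<or> F (bar v) = - F v"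
    if v: "v \<in> V" for v
  proof -
    have vE: "v \<in> ?E" and vi: "\<And>i. i \<in> S \<Longrightarrow> if i < n - 1 then v i = i else v i \<in> {?x, ?y}"
      using v by (auto simp: V_def)
    have vlt: "v i < n" "v i \<noteq> n - 1" if "i \<in> S" for i
      using vi[OF that] vE that d by (auto split: if_splits)
    have tlt: "t k < n" if "k < n" for k using that d by (auto simp: t_def transpose_def)
    have barE: "bar v \<in> ?E" using vlt tlt by (auto simp: bar_def)
    have "if i < n - 1 then bar v i = i else bar v i \<in> {?x, ?y}" if "i \<in> S" for i
    proof (cases "i < n - 1")
      case True
      moreover have "i \<noteq> ?x" "i \<noteq> ?y" using that r by auto
      ultimately show ?thesis using vi[OF that] that by (simp add: bar_def t_def)
    next
      case False
      then show ?thesis using vi[OF that] that by (auto simp: bar_def t_def)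
    qed
    then show "bar v \<in> V" unfolding V_def using barE by blast
    show "bar (bar v) = v"
      using vE by (auto simp: bar_def t_def fun_eq_iff restrict_def PiE_iff extensional_def)
    have "F v = lookup (act n ?H p) (word_monom S v)"
      using pI[OF rotation_SO[OF n r(1)]] by (simp add: F_def)
    also have "\<dots> = F (bar v) * (\<Prod>i\<in>S. ?H $$ (bar v i, v i))"
      unfolding F_def
    proof (rule lookup_act_monomial[OF pR S vlt(1) barE])
      fix i k assume "i \<in> S" "k < n" "k \<noteq> bar v i"
      then show "?H $$ (k, v i) = 0" using H[of k "v i"] vlt[of i] by (simp add: bar_def)
    qed
    finally have "F v = F (bar v) * (\<Prod>i\<in>S. ?H $$ (bar v i, v i))" .
    moreover have "(\<Prod>i\<in>S. ?H $$ (bar v i, v i)) \<in> {1, -1}"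
    proof -
      have "(\<Prod>i\<in>T. ?H $$ (bar v i, v i)) \<in> {1, -1}" if "T \<subseteq> S" for T
      proof -
        have "finite T" using that fin finite_subset by blast
        then show ?thesis using that
        proof (induction T rule: finite_induct)
          case (insert i T)
          have "?H $$ (bar v i, v i) \<in> {1, -1}"
            using insert.prems H[of "bar v i" "v i"] vlt[of i] tlt[of "v i"] by (auto simp: bar_def)
          then show ?case using insert by auto
        qed simp
      qed
      then show ?thesis by blast
    qed
    ultimately show "F (bar v) = F v \<or> F (bar v) = - F v" by auto
  qed
  let ?V0 = "{v \<in> V. v z = ?x}" and ?V1 = "{v \<in> V. v z \<noteq> ?x}"
  have "(\<Sum>v\<in>V. F v) = (\<Sum>v\<in>?V0. F v) + (\<Sum>v\<in>?V1. F v)"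
    using finV by (subst sum.union_disjoint[symmetric]) (auto intro!: sum.cong)
  also have "(\<Sum>v\<in>?V1. F v) = (\<Sum>v\<in>?V0. F (bar v))"
  proof (rule sum.reindex_bij_witness[where i = bar and j = bar])
    have bz: "bar v z = t (v z)" for v using z by (simp add: bar_def)
    have vz: "v z = ?x \<or> v z = ?y" if "v \<in> V" for v using that z by (auto simp: V_def)
    show "bar v \<in> ?V0" if "v \<in> ?V1" for v using that vz[of v] bar_V by (auto simp: bz t_def)
    show "bar v \<in> ?V1" if "v \<in> ?V0" for v using that bar_V by (auto simp: bz t_def)
  qed (auto simp: bar_bar)
  finally have "F ?w / 2 = (\<Sum>v\<in>?V0. (F v + F (bar v)) / 2)"
    unfolding sumV by (simp add: sum.distrib add_divide_distrib sum_divide_distrib)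
  also have "\<dots> \<in> \<int>"
  proof (rule Ints_sum)
    fix v assume "v \<in> ?V0"
    then have "F (bar v) = F v \<or> F (bar v) = - F v" using bar_F by simp
    then show "(F v + F (bar v)) / 2 \<in> \<int>" using pZ[of v] by auto
  qed
  finally show ?thesis by (simp add: F_def)
qed

text \<open>If S and its complement both respect the pairs, then the one that does not contain all pairs but
  contains a z has an even coefficient. Such a part exists: if S has no z, then its complement has
  one and misses a pair of S; if S has a z and all pairs, then its complement has only z's.\<close>

lemma coeff_proper_product_even:
  assumes n: "odd n" "3 \<le> n" and m: "n \<le> m"
    and p: "p \<in> invariantsZ n m (SO_group n)" and q: "q \<in> invariantsZ n m (SO_group n)"
    and S: "S \<subseteq> {..<m}" "S \<noteq> {}" "S \<noteq> {..<m}"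
  shows "lookup p (word_monom S (standard_word n)) * lookup q (word_monom ({..<m} - S) (standard_word n)) / 2 \<in> \<int>"
proof (cases "\<exists>r<n div 2. (2 * r \<in> S) \<noteq> (2 * r + 1 \<in> S)")
  case True
  then have "lookup p (word_monom S (standard_word n)) = 0"
    using coeff_unbalanced[OF n(1) _ S(1), of p] p by (auto simp: invariantsZ_def)
  then show ?thesis by simp
next
  case False
  let ?T = "{..<m} - S"
  have pairs: "2 * r \<in> S \<longleftrightarrow> 2 * r + 1 \<in> S" if "r < n div 2" for r using False that by blast
  have pair_of: "\<exists>r<n div 2. i = 2 * r \<or> i = 2 * r + 1" if "i < n - 1" for i
    by (rule exI[of _ "i div 2"]) (use that n(1) in \<open>auto elim!: oddE\<close>)
  have pair_lt: "2 * r < m" "2 * r + 1 < m" if "r < n div 2" for r using that n(1) m by (auto elim!: oddE)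
  have ints: "lookup p t \<in> \<int>" "lookup q t \<in> \<int>" for t
    using p q by (auto simp: invariantsZ_def RZpolys_def)
  have cases: "(\<exists>z\<in>S. n - 1 \<le> z) \<and> (\<exists>r<n div 2. 2 * r \<notin> S \<and> 2 * r + 1 \<notin> S) \<or>
      (\<exists>z\<in>?T. n - 1 \<le> z) \<and> (\<exists>r<n div 2. 2 * r \<notin> ?T \<and> 2 * r + 1 \<notin> ?T)"
  proof (cases "\<exists>z\<in>S. n - 1 \<le> z")
    case True
    show ?thesis
    proof (cases "\<exists>r<n div 2. 2 * r \<notin> S \<and> 2 * r + 1 \<notin> S")
      case False
      then have all: "2 * r \<in> S" "2 * r + 1 \<in> S" if "r < n div 2" for r using pairs that by blast+
      obtain z where z: "z \<in> ?T" using S by blast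
      have "n - 1 \<le> z"
      proof (rule ccontr)
        assume "\<not> n - 1 \<le> z"
        then show False using pair_of[of z] all z by auto
      qed
      moreover have "0 < n div 2" using n by simp
      ultimately show ?thesis using z all by blast
    qed (use True in blast)
  next
    case False
    obtain s where s: "s \<in> S" using S by blast
    then have "s < n - 1" using False by force
    then obtain r where r: "r < n div 2" "s = 2 * r \<or> s = 2 * r + 1" using pair_of by blast
    then have "2 * r \<in> S" "2 * r + 1 \<in> S" using s pairs by auto
    moreover have "n - 1 \<in> ?T" using False m n(2) by auto
    ultimately show ?thesis using r(1) by blast
  qed
  then show ?thesis
  proof (elim disjE conjE bexE exE)
    fix z r assume "z \<in> S" "n - 1 \<le> z" "r < n div 2" "2 * r \<notin> S" "2 * r + 1 \<notin> S"
    then have "lookup p (word_monom S (standard_word n)) / 2 \<in> \<int>"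
      by (intro coeff_even[OF n(1) p S(1)])
    from Ints_mult[OF this ints(2)] show ?thesis by simp
  next
    fix z r assume "z \<in> ?T" "n - 1 \<le> z" "r < n div 2" "2 * r \<notin> ?T" "2 * r + 1 \<notin> ?T"
    then have "lookup q (word_monom ?T (standard_word n)) / 2 \<in> \<int>"
      by (intro coeff_even[OF n(1) q]) auto
    from Ints_mult[OF ints(1) this] show ?thesis by simp
  qed
qed

section \<open>Indecomposability\<close>

lemma mdegree_word_monom:
  assumes "finite S"
  shows "mdegree (word_monom S w) = card S"
proof -
  have keys: "keys (word_monom S w) = (\<lambda>i. (w i, i)) ` S"
  proof (rule Set.set_eqI)
    fix v show "v \<in> keys (word_monom S w) \<longleftrightarrow> v \<in> (\<lambda>i. (w i, i)) ` S"
      by (cases v) (auto simp: in_keys_iff lookup_word_monom[OF assms])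
  qed
  have "mdegree (word_monom S w) = (\<Sum>i\<in>S. lookup (word_monom S w) (w i, i))"
    unfolding mdegree_def keys by (subst sum.reindex) (auto simp: inj_on_def)
  then show ?thesis by (simp add: lookup_word_monom[OF assms])
qed

lemma tdegree_multilinear:
  assumes "multilinear n m p"
  shows "tdegree p \<le> m"
proof -
  have "mdegree t \<le> m" if t: "t \<in> keys p" for t
  proof -
    obtain w where "t = word_monom {..<m} w" using multilinear_key[OF assms t] by blast
    then show ?thesis by (simp add: mdegree_word_monom)
  qed
  then show ?thesis unfolding tdegree_def by (intro Max.boundedI) auto
qed

text \<open>Taking the coefficient at the standard word is not multiplicative, yet its evenness passes from
  integral invariants to their products: each way to distribute the word to two factors contributes an
  even number, by hypothesis on a factor that gets the whole word, and otherwise by the previous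
  lemma. The generators have no monomial of degree m at all.\<close>

lemma indecomposable_criterion:
  assumes n: "odd n" "3 \<le> n" and m: "n \<le> m" and G: "SO_group n \<subseteq> G"
    and p: "p \<in> invariantsZ n m G" "multilinear n m p"
    and coeff: "lookup p (word_monom {..<m} (standard_word n)) = 1"
  shows "indecomposable n m G p"
proof -
  let ?W = "word_monom {..<m} (standard_word n)"
  have sub: "invariantsZ n m G \<subseteq> invariantsZ n m (SO_group n)"
    using G by (auto simp: invariantsZ_def invariants_def)
  have m0: "0 < m" using n m by simp
  have generated: "f \<in> invariantsZ n m (SO_group n) \<and> lookup f ?W / 2 \<in> \<int>"
    if "f \<in> subring_generated {f \<in> invariantsZ n m G. tdegree f < tdegree p}" for f
    using that
  proof (induction rule: subring_generated.induct)
    case one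
    have "mdegree ?W = m" by (simp add: mdegree_word_monom)
    then have "?W \<noteq> 0" using m0 by (auto simp: mdegree_def)
    then show ?case by (simp add: invariantsZ_1 lookup_one)
  next
    case (incl f)
    have "?W \<notin> keys f"
    proof
      assume "?W \<in> keys f"
      then have "mdegree ?W \<le> tdegree f" unfolding tdegree_def by (intro Max_ge) auto
      then show False using incl tdegree_multilinear[OF p(2)] by (simp add: mdegree_word_monom)
    qed
    then show ?case using incl sub by (auto simp: in_keys_iff)
  next
    case (uminus f)
    then show ?case by (simp add: invariantsZ_uminus)
  next
    case (add f g)
    then show ?case by (simp add: invariantsZ_add lookup_add add_divide_distrib)
  next
    case (mult f g)
    have ints: "lookup f t \<in> \<int>" "lookup g t \<in> \<int>" for t
      using mult by (auto simp: invariantsZ_def RZpolys_def)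
    have even: "lookup f t * lookup g u / 2 \<in> \<int>" if tu: "t + u = ?W" for t u
    proof -
      obtain T where T: "T \<subseteq> {..<m}" "t = word_monom T (standard_word n)"
          "u = word_monom ({..<m} - T) (standard_word n)"
        using word_monom_split[OF finite_lessThan tu] by blast
      consider "T = {}" | "T = {..<m}" | "T \<noteq> {}" "T \<noteq> {..<m}" by blast
      then show ?thesis
      proof cases
        case 1
        then have "lookup g u / 2 \<in> \<int>" using mult T by simp
        from Ints_mult[OF ints(1) this] show ?thesis by simp
      next
        case 2
        then have "lookup f t / 2 \<in> \<int>" using mult T by simp
        from Ints_mult[OF this ints(2)] show ?thesis by simp
      next
        case 3
        then show ?thesis
          unfolding T(2,3) using mult by (intro coeff_proper_product_even[OF n m _ _ T(1)]) auto
      qed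
    qed
    have "lookup (f * g) ?W / 2 = (\<Sum>t\<in>keys f. \<Sum>u\<in>keys g. if t + u = ?W then lookup f t * lookup g u / 2 else 0)"
      unfolding lookup_times sum_divide_distrib by (intro sum.cong refl) auto
    also have "\<dots> \<in> \<int>" using even by (intro Ints_sum) auto
    finally show ?case using mult by (simp add: invariantsZ_mult)
  qed
  have half: "(1 :: complex) / 2 \<notin> \<int>"
  proof
    assume "(1 :: complex) / 2 \<in> \<int>"
    then obtain k where "(1 :: complex) / 2 = of_int k" by (elim Ints_cases)
    then have "complex_of_int 1 = of_int (2 * k)" by (simp add: field_simps)
    then have "1 = 2 * k" by (simp only: of_int_eq_iff)
    then show False by presburger
  qed
  have "p \<notin> subring_generated {f \<in> invariantsZ n m G. tdegree f < tdegree p}"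
  proof
    assume "p \<in> subring_generated {f \<in> invariantsZ n m G. tdegree f < tdegree p}"
    then have "lookup p ?W / 2 \<in> \<int>" by (rule generated[THEN conjunct2])
    then show False using half unfolding coeff by contradiction
  qed
  then show ?thesis using p(1) by (simp add: indecomposable_def)
qed

lemma g_poly_coeffs:
  assumes n: "odd n" and m: "n \<le> m" "even m"
  shows "multilinear n m (g_poly n m)" and "lookup (g_poly n m) t \<in> \<int>"
    and "lookup (g_poly n m) (word_monom {..<m} (standard_word n)) = 1"
proof -
  have d: "0 = 0 \<or> (0::nat) = n" and l: "m = 0 + 2 * (m div 2)" using m(2) by simp_all
  show "multilinear n m (g_poly n m)" unfolding g_poly_eq_pairing_sum by (rule scaled_pairing_sum(1)[OF n d l m(1)])
  show "lookup (g_poly n m) t \<in> \<int>" unfolding g_poly_eq_pairing_sum by (rule scaled_pairing_sum(2)[OF n d l m(1)])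
  show "lookup (g_poly n m) (word_monom {..<m} (standard_word n)) = 1"
    unfolding g_poly_eq_pairing_sum by (rule scaled_pairing_sum(3)[OF n d l m(1)])
qed

lemma h_poly_coeffs:
  assumes n: "odd n" and m: "n \<le> m" "odd m"
  shows "multilinear n m (h_poly n m)" and "lookup (h_poly n m) t \<in> \<int>"
    and "lookup (h_poly n m) (word_monom {..<m} (standard_word n)) = 1"
proof -
  have d: "n = 0 \<or> n = n" and l: "m = n + 2 * ((m - n) div 2)" using n m by simp_all
  note h = h_poly_eq_pairing_sum[OF l]
  show "multilinear n m (h_poly n m)" unfolding h by (rule scaled_pairing_sum(1)[OF n d l m(1)])
  show "lookup (h_poly n m) t \<in> \<int>" unfolding h by (rule scaled_pairing_sum(2)[OF n d l m(1)])
  show "lookup (h_poly n m) (word_monom {..<m} (standard_word n)) = 1"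
    unfolding h by (rule scaled_pairing_sum(3)[OF n d l m(1)])
qed

theorem mainTheorem6:
  fixes n m :: nat
  assumes "odd n" and "n \<ge> 3" and "m \<ge> n"
  shows "(even m \<longrightarrow>
            multilinear n m (g_poly n m) \<and>
            indecomposable n m (SO_group n) (g_poly n m) \<and>
            indecomposable n m (O_group n) (g_poly n m)) \<and>
         (odd m \<longrightarrow>
            multilinear n m (h_poly n m) \<and>
            indecomposable n m (SO_group n) (h_poly n m))"
proof -
  note n = assms(1,2) and m = assms(3)
  have SO_O: "SO_group n \<subseteq> O_group n" by (auto simp: SO_group_def)
  have g: "multilinear n m (g_poly n m)" "indecomposable n m (SO_group n) (g_poly n m)"
    "indecomposable n m (O_group n) (g_poly n m)" if "even m"
  proof -
    note coeffs = g_poly_coeffs[OF n(1) m that]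
    show "multilinear n m (g_poly n m)" by (rule coeffs)
    have O: "g_poly n m \<in> invariantsZ n m (O_group n)"
      using coeffs(1,2) g_poly_invariant[OF n(1)]
      by (simp add: invariantsZ_def invariants_def RZpolys_def multilinear_def)
    then have SO: "g_poly n m \<in> invariantsZ n m (SO_group n)"
      using SO_O by (auto simp: invariantsZ_def invariants_def)
    show "indecomposable n m (SO_group n) (g_poly n m)"
      by (rule indecomposable_criterion[OF n m subset_refl SO coeffs(1,3)])
    show "indecomposable n m (O_group n) (g_poly n m)"
      by (rule indecomposable_criterion[OF n m SO_O O coeffs(1,3)])
  qed
  have h: "multilinear n m (h_poly n m)" "indecomposable n m (SO_group n) (h_poly n m)" if "odd m"
  proof -
    note coeffs = h_poly_coeffs[OF n(1) m that]
    show "multilinear n m (h_poly n m)" by (rule coeffs)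
    have SO: "h_poly n m \<in> invariantsZ n m (SO_group n)"
      using coeffs(1,2) h_poly_invariant[OF n(1)]
      by (simp add: invariantsZ_def invariants_def RZpolys_def multilinear_def)
    show "indecomposable n m (SO_group n) (h_poly n m)"
      by (rule indecomposable_criterion[OF n m subset_refl SO coeffs(1,3)])
  qed
  show ?thesis using g h by blast
qed


end
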